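(* Let $\mathcal S=\{1,\dots,N\}$ with $N>1$, let $d\ge 1$, and let $v_1,\dots,v_N\in\mathbb R^d$ be vectors, not all zero, with $d=\dim(\operatorname{span}\{v_1,\dots,v_N\})$. For $i\neq j$ let $a_{ij}:\mathbb R^d\to[0,\infty)$ be continuous functions. Let $(X,L)$ be the continuous-time Markov process on $\mathcal S\times\mathbb R^d$ with generator \[Af(j,l)=v_j\cdot\nabla_l f(j,l)+\sum_{i\neq j}a_{ji}(l)\,[f(i,l)-f(j,l)],\qquad j\in\mathcal S,\ l\in\mathbb R^d,\] i.e. $L(t)=L(0)+\sum_{j}v_j\,\mu(\{s\in[0,t]:X(s)=j\})$ ($\mu$ Lebesgue measure) and $X$ jumps from $i$ to $j$ at rate $a_{ij}(L(t))$. Assume $(X,L)$ is Harris irreducible. Let $p_1,\dots,p_N>0$ with $\sum_j p_j=1$ and let $g:\mathbb R^d\to[0,\infty)$ be a differentiable function with $\int_{\mathbb R^d}g(l)\,dl=1$. Then the probability measure $p_j\,g(l)\,dj\,dl$ on $\mathcal S\times\mathbb R^d$ (counting measure in $j$, Lebesgue measure in $l$) is invariant for $(X,L)$ if and only if \[-p_j v_j\cdot\nabla g(l)+\sum_{i\neq j}\big[p_i a_{ij}(l)g(l)-p_j a_{ji}(l)g(l)\big]=0\qquad\text{for all } j=1,\dots,N,\ l\in\mathbb R^d.\]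
   Context: Harris irreducibility means: there exist an open set $U\subset\mathbb R^d$ and $j_0\in\mathcal S$ such that for every starting point $(x,l)\in\mathcal S\times\mathbb R^d$ there is $t>0$ with $P((X(t),L(t))\in\{j_0\}\times U)>0$. *)

theory Defs
  imports "HOL-Analysis.Analysis"
begin

text \<open>Piecewise deterministic Markov process on S x R^d: in mode j the position
moves with velocity v j; from mode j the process jumps to mode i (i in S, i ~= j)
at rate a j i (current position).\<close>

definition pdmp_rate :: "nat set \<Rightarrow> (nat \<Rightarrow> nat \<Rightarrow> 'a \<Rightarrow> real) \<Rightarrow> nat \<Rightarrow> 'a \<Rightarrow> real" where
  "pdmp_rate S a j l = (\<Sum>i\<in>S - {j}. a j i l)"

definition pdmp_surv :: "nat set \<Rightarrow> (nat \<Rightarrow> nat \<Rightarrow> 'a::euclidean_space \<Rightarrow> real) \<Rightarrow> (nat \<Rightarrow> 'a)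
    \<Rightarrow> nat \<Rightarrow> 'a \<Rightarrow> real \<Rightarrow> real" where
  "pdmp_surv S a v j l s = exp (- integral {0..s} (\<lambda>u. pdmp_rate S a j (l + u *\<^sub>R v j)))"

text \<open>pdmp_K S a v n t x B: probability that starting from x the process has made exactly
n jumps up to time t and is in B at time t (first-jump decomposition).\<close>
fun pdmp_K :: "nat set \<Rightarrow> (nat \<Rightarrow> nat \<Rightarrow> 'a::euclidean_space \<Rightarrow> real) \<Rightarrow> (nat \<Rightarrow> 'a)
    \<Rightarrow> nat \<Rightarrow> real \<Rightarrow> nat \<times> 'a \<Rightarrow> (nat \<times> 'a) set \<Rightarrow> ennreal" where
  "pdmp_K S a v 0 t (j, l) B =
     ennreal (pdmp_surv S a v j l t) * indicator B (j, l + t *\<^sub>R v j)"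
| "pdmp_K S a v (Suc n) t (j, l) B =
     (\<integral>\<^sup>+ s. indicator {0..t} s * ennreal (pdmp_surv S a v j l s) *
        (\<Sum>i\<in>S - {j}. ennreal (a j i (l + s *\<^sub>R v j)) *
           pdmp_K S a v n (t - s) (i, l + s *\<^sub>R v j) B) \<partial>lborel)"

definition pdmp_P :: "nat set \<Rightarrow> (nat \<Rightarrow> nat \<Rightarrow> 'a::euclidean_space \<Rightarrow> real) \<Rightarrow> (nat \<Rightarrow> 'a)
    \<Rightarrow> real \<Rightarrow> nat \<times> 'a \<Rightarrow> (nat \<times> 'a) set \<Rightarrow> ennreal" where
  "pdmp_P S a v t x B = (\<Sum>n. pdmp_K S a v n t x B)"

definition pdmp_harris_irreducible :: "nat set \<Rightarrow> (nat \<Rightarrow> nat \<Rightarrow> 'a::euclidean_space \<Rightarrow> real)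
    \<Rightarrow> (nat \<Rightarrow> 'a) \<Rightarrow> bool" where
  "pdmp_harris_irreducible S a v \<longleftrightarrow>
     (\<exists>U j0. open U \<and> j0 \<in> S \<and>
        (\<forall>j\<in>S. \<forall>l. \<exists>t>0. pdmp_P S a v t (j, l) ({j0} \<times> U) > 0))"

definition pdmp_invariant :: "nat set \<Rightarrow> (nat \<Rightarrow> nat \<Rightarrow> 'a::euclidean_space \<Rightarrow> real)
    \<Rightarrow> (nat \<Rightarrow> 'a) \<Rightarrow> (nat \<Rightarrow> 'a \<Rightarrow> real) \<Rightarrow> bool" where
  "pdmp_invariant S a v dens \<longleftrightarrow>
     (\<forall>t\<ge>0. \<forall>B\<in>sets (count_space UNIV \<Otimes>\<^sub>M (borel :: 'a measure)).
        (\<Sum>j\<in>S. \<integral>\<^sup>+ l. ennreal (dens j l) * pdmp_P S a v t (j, l) B \<partial>lborel)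
      = (\<Sum>j\<in>S. \<integral>\<^sup>+ l. ennreal (dens j l) * indicator B (j, l) \<partial>lborel))"

end

theory Submission
  imports Defs
begin

text \<open>
  Write \<open>U\<^sub>s\<close> for the motion until time \<open>s\<close> weighted with the survival probability, \<open>J\<close> for the jump
  operator, \<open>K\<^sub>n(t)\<close> for the kernel of exactly \<open>n\<close> jumps and \<open>\<pi>\<close> for the measure with densities
  \<open>q\<^sub>j\<close>. By the fundamental theorem of calculus along the lines with direction \<open>v\<^sub>j\<close>, the
  stationary equation holds everywhere if and only if
  \<open>\<pi> f = \<pi> U\<^sub>t f + \<integral>\<^sub>0\<^sup>t \<pi> J U\<^sub>s f ds\<close> for all \<open>t \<ge> 0\<close> and all measurable \<open>f \<ge> 0\<close>; since only
  directional derivatives occur, continuity of the gradient plays no role. If \<open>\<pi>\<close> is invariant, this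
  identity follows from the decomposition at the last jump, in which \<open>\<pi> P\<^sub>t\<^sub>-\<^sub>s = \<pi>\<close> can be
  cancelled. Conversely, iterating the identity gives
  \<open>\<pi> f = (\<Sum>k\<le>n. \<pi> K\<^sub>k(t) f) + \<integral>\<^sub>0\<^sup>t \<pi> J K\<^sub>n(s) f ds\<close>, and for \<open>f \<le> 1\<close> with bounded
  support the remainder vanishes as \<open>n \<rightarrow> \<infinity>\<close>, because the rates are bounded on the bounded region
  from which the support can be reached.
\<close>

subsection \<open>Integration on Euclidean space\<close>

lemma measurable_indicator_atLeastAtMost [measurable (raw)]:
  fixes \<sigma> \<tau> :: "'m \<Rightarrow> real"
  assumes [measurable]: "\<sigma> \<in> borel_measurable M" "\<tau> \<in> borel_measurable M"
  shows "(\<lambda>m. indicator {0..\<tau> m} (\<sigma> m) :: ennreal) \<in> borel_measurable M"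
  unfolding indicator_def by simp

text \<open>Both sides integrate over the triangle \<open>s, r \<ge> 0\<close>,
  \<open>s + r \<le> t\<close>: after Tonelli, the translation \<open>w = s + r\<close> at fixed
  \<open>r\<close> replaces the first duration by the total one. Needed in
  \<open>mean_iterate\<close>, where \<open>w\<close> becomes the new time variable of the
  remainder.\<close>

lemma nn_integral_triangle_shift:
  fixes \<psi> :: "real \<Rightarrow> real \<Rightarrow> ennreal"
  assumes [measurable]: "(\<lambda>(s, r). \<psi> s r) \<in> borel_measurable (lborel \<Otimes>\<^sub>M lborel)"
  shows "(\<integral>\<^sup>+ s. indicator {0..t} s * (\<integral>\<^sup>+ r. indicator {0..t - s} r * \<psi> s r \<partial>lborel) \<partial>lborel) =
    (\<integral>\<^sup>+ w. indicator {0..t} w * (\<integral>\<^sup>+ r. indicator {0..w} r * \<psi> (w - r) r \<partial>lborel) \<partial>lborel)"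
proof -
  have "(\<integral>\<^sup>+ s. indicator {0..t} s * (\<integral>\<^sup>+ r. indicator {0..t - s} r * \<psi> s r \<partial>lborel) \<partial>lborel) =
    (\<integral>\<^sup>+ s. \<integral>\<^sup>+ r. indicator {0..t} s * (indicator {0..t - s} r * \<psi> s r) \<partial>lborel \<partial>lborel)"
    by (intro nn_integral_cong nn_integral_cmult[symmetric]) measurable
  also have "\<dots> = (\<integral>\<^sup>+ r. \<integral>\<^sup>+ s. indicator {0..t} s * (indicator {0..t - s} r * \<psi> s r) \<partial>lborel \<partial>lborel)"
    by (intro lborel_pair.Fubini'[symmetric]) measurable
  also have "\<dots> = (\<integral>\<^sup>+ r. \<integral>\<^sup>+ w. indicator {0..t} (w - r) * (indicator {0..t - (w - r)} r * \<psi> (w - r) r) \<partial>lborel \<partial>lborel)"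
  proof (rule nn_integral_cong)
    fix r :: real
    show "(\<integral>\<^sup>+ s. indicator {0..t} s * (indicator {0..t - s} r * \<psi> s r) \<partial>lborel) =
      (\<integral>\<^sup>+ w. indicator {0..t} (w - r) * (indicator {0..t - (w - r)} r * \<psi> (w - r) r) \<partial>lborel)"
      by (subst nn_integral_real_affine[where c = 1 and t = "- r"]) (auto simp: algebra_simps)
  qed
  also have "\<dots> = (\<integral>\<^sup>+ r. \<integral>\<^sup>+ w. indicator {0..t} w * (indicator {0..w} r * \<psi> (w - r) r) \<partial>lborel \<partial>lborel)"
    by (intro nn_integral_cong) (auto split: split_indicator)
  also have "\<dots> = (\<integral>\<^sup>+ w. \<integral>\<^sup>+ r. indicator {0..t} w * (indicator {0..w} r * \<psi> (w - r) r) \<partial>lborel \<partial>lborel)"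
    by (intro lborel_pair.Fubini') measurable
  also have "\<dots> = (\<integral>\<^sup>+ w. indicator {0..t} w * (\<integral>\<^sup>+ r. indicator {0..w} r * \<psi> (w - r) r \<partial>lborel) \<partial>lborel)"
    by (intro nn_integral_cong nn_integral_cmult) measurable
  finally show ?thesis .
qed

text \<open>The triangle \<open>s, r \<ge> 0\<close>, \<open>s + r \<le> t\<close> is symmetric in
  its two coordinates, so Tonelli exchanges the time \<open>s\<close> before the first jump with the
  time \<open>r\<close> after the last one in \<open>kern_last_jump\<close>.\<close>

lemma nn_integral_triangle_swap:
  fixes \<psi> :: "real \<Rightarrow> real \<Rightarrow> ennreal"
  assumes [measurable]: "(\<lambda>(s, r). \<psi> s r) \<in> borel_measurable (lborel \<Otimes>\<^sub>M lborel)"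
  shows "(\<integral>\<^sup>+ s. indicator {0..t} s * (\<integral>\<^sup>+ r. indicator {0..t - s} r * \<psi> s r \<partial>lborel) \<partial>lborel) =
    (\<integral>\<^sup>+ r. indicator {0..t} r * (\<integral>\<^sup>+ s. indicator {0..t - r} s * \<psi> s r \<partial>lborel) \<partial>lborel)"
proof -
  have "(\<integral>\<^sup>+ s. indicator {0..t} s * (\<integral>\<^sup>+ r. indicator {0..t - s} r * \<psi> s r \<partial>lborel) \<partial>lborel) =
    (\<integral>\<^sup>+ s. \<integral>\<^sup>+ r. indicator {0..t} s * (indicator {0..t - s} r * \<psi> s r) \<partial>lborel \<partial>lborel)"
    by (intro nn_integral_cong nn_integral_cmult[symmetric]) measurable
  also have "\<dots> = (\<integral>\<^sup>+ r. \<integral>\<^sup>+ s. indicator {0..t} s * (indicator {0..t - s} r * \<psi> s r) \<partial>lborel \<partial>lborel)"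
    by (intro lborel_pair.Fubini'[symmetric]) measurable
  also have "\<dots> = (\<integral>\<^sup>+ r. \<integral>\<^sup>+ s. indicator {0..t} r * (indicator {0..t - r} s * \<psi> s r) \<partial>lborel \<partial>lborel)"
    by (intro nn_integral_cong) (auto split: split_indicator)
  also have "\<dots> = (\<integral>\<^sup>+ r. indicator {0..t} r * (\<integral>\<^sup>+ s. indicator {0..t - r} s * \<psi> s r \<partial>lborel) \<partial>lborel)"
    by (intro nn_integral_cong nn_integral_cmult) measurable
  finally show ?thesis .
qed

lemma nn_integral_reflect:
  fixes f :: "real \<Rightarrow> ennreal"
  assumes [measurable]: "f \<in> borel_measurable lborel"
  shows "(\<integral>\<^sup>+ s. indicator {0..t} s * f s \<partial>lborel) = (\<integral>\<^sup>+ s. indicator {0..t} s * f (t - s) \<partial>lborel)"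
proof -
  have "(\<integral>\<^sup>+ s. indicator {0..t} s * f s \<partial>lborel) = (\<integral>\<^sup>+ s. indicator {0..t} (t - s) * f (t - s) \<partial>lborel)"
    using assms by (subst nn_integral_real_affine[where c = "-1" and t = t]) auto
  also have "\<dots> = (\<integral>\<^sup>+ s. indicator {0..t} s * f (t - s) \<partial>lborel)"
    by (intro nn_integral_cong) (auto split: split_indicator)
  finally show ?thesis .
qed

lemma nn_integral_lborel_shift:
  fixes f :: "'a::euclidean_space \<Rightarrow> ennreal"
  assumes "f \<in> borel_measurable lborel"
  shows "(\<integral>\<^sup>+ l. f (l + c) \<partial>lborel) = (\<integral>\<^sup>+ l. f l \<partial>lborel)"
proof -
  have "(\<integral>\<^sup>+ l. f l \<partial>lborel) = (\<integral>\<^sup>+ l. f l \<partial>(distr lborel borel ((+) c)))"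
    by (simp add: lborel_distr_plus)
  also have "\<dots> = (\<integral>\<^sup>+ l. f (l + c) \<partial>lborel)"
    using assms by (subst nn_integral_distr) (auto simp: add.commute)
  finally show ?thesis ..
qed

text \<open>A strict inequality at one point persists with a gap on a small ball, and a ball has
  positive finite measure, so the two integrals over it would differ. This turns equality of
  densities as measures into pointwise equality.\<close>

lemma continuous_eqI_nn_integral_ball:
  fixes f h :: "'a::euclidean_space \<Rightarrow> real"
  assumes f: "continuous_on UNIV f" and h: "continuous_on UNIV h"
    and nonneg: "\<And>x. f x \<ge> 0" "\<And>x. h x \<ge> 0"
    and eq: "\<And>x r. (\<integral>\<^sup>+ y. ennreal (f y) * indicator (ball x r) y \<partial>lborel) =
      (\<integral>\<^sup>+ y. ennreal (h y) * indicator (ball x r) y \<partial>lborel)"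
  shows "f x = h x"
proof -
  \<comment> \<open>One inequality is excluded for arbitrary \<open>f\<close> and \<open>h\<close>,
    so that it can be used in both directions.\<close>
  have *: "\<not> f x < h x"
    if f: "continuous_on UNIV f" and h: "continuous_on UNIV h"
    and nonneg: "\<And>x. f x \<ge> 0" "\<And>x. h x \<ge> 0"
    and eq: "\<And>r. (\<integral>\<^sup>+ y. ennreal (f y) * indicator (ball x r) y \<partial>lborel) =
      (\<integral>\<^sup>+ y. ennreal (h y) * indicator (ball x r) y \<partial>lborel)" for f h :: "'a \<Rightarrow> real"
  proof
    assume less: "f x < h x"
    \<comment> \<open>A third of the gap leaves \<open>f x + c < h x - c\<close>, so the oscillation
      bounds of both functions stay strictly apart.\<close>
    define c where "c = (h x - f x) / 3"
    have c: "c > 0" using less by (simp add: c_def)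
    obtain r1 where r1: "r1 > 0" "\<And>y. dist y x < r1 \<Longrightarrow> dist (f y) (f x) < c"
      using f c unfolding continuous_on_iff by blast
    obtain r2 where r2: "r2 > 0" "\<And>y. dist y x < r2 \<Longrightarrow> dist (h y) (h x) < c"
      using h c unfolding continuous_on_iff by blast
    define r where "r = min r1 r2"
    have r: "r > 0" using r1 r2 by (simp add: r_def)
    have fin: "emeasure lborel (ball x r) < \<infinity>"
      by (rule emeasure_lborel_ball_finite)
    have pos: "emeasure lborel (ball x r) > 0"
      using content_ball_pos[OF r, of x] by (auto simp: measure_def enn2real_positive_iff)
    have "ennreal (f x + c) * emeasure lborel (ball x r) < ennreal (h x - c) * emeasure lborel (ball x r)"
    proof -
      have "f x + c < h x - c" using less by (simp add: c_def field_simps)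
      then have "ennreal (f x + c) < ennreal (h x - c)"
        using nonneg(1)[of x] c by (intro ennreal_lessI) auto
      then show ?thesis
        using fin pos by (intro ennreal_mult_strict_right_mono) (auto simp: top.not_eq_extremum)
    qed
    also have "\<dots> = (\<integral>\<^sup>+ y. ennreal (h x - c) * indicator (ball x r) y \<partial>lborel)"
      by (simp add: nn_integral_cmult_indicator)
    also have "\<dots> \<le> (\<integral>\<^sup>+ y. ennreal (h y) * indicator (ball x r) y \<partial>lborel)"
    proof (rule nn_integral_mono)
      fix y
      show "ennreal (h x - c) * indicator (ball x r) y \<le> ennreal (h y) * indicator (ball x r) y"
        using r2(2)[of y] by (auto simp: r_def dist_commute dist_real_def abs_if split: split_indicator if_splits intro!: ennreal_leI)
    qed
    also have "\<dots> = (\<integral>\<^sup>+ y. ennreal (f y) * indicator (ball x r) y \<partial>lborel)"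
      using eq by simp
    also have "\<dots> \<le> (\<integral>\<^sup>+ y. ennreal (f x + c) * indicator (ball x r) y \<partial>lborel)"
    proof (rule nn_integral_mono)
      fix y
      show "ennreal (f y) * indicator (ball x r) y \<le> ennreal (f x + c) * indicator (ball x r) y"
        using r1(2)[of y] by (auto simp: r_def dist_commute dist_real_def abs_if split: split_indicator if_splits intro!: ennreal_leI)
    qed
    also have "\<dots> = ennreal (f x + c) * emeasure lborel (ball x r)"
      by (simp add: nn_integral_cmult_indicator)
    finally show False by simp
  qed
  show ?thesis
    using *[OF f h nonneg eq] *[OF h f nonneg(2,1) eq[symmetric]] by simp
qed

text \<open>The set is an interval of length \<open>c\<close>, a half line if \<open>c\<close> is
  infinite. It serves to write a function as an integral of indicators of its superlevel
  sets.\<close>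

lemma nn_integral_layer_cake:
  "(\<integral>\<^sup>+ r. indicator {r. 0 \<le> r \<and> ennreal r < c} r \<partial>lborel) = c"
proof (cases c)
  case (real x)
  then have "{r. 0 \<le> r \<and> ennreal r < c} = {0..<x}"
    by (auto simp: ennreal_less_iff)
  then show ?thesis using real by simp
next
  case top
  then have "{r. 0 \<le> r \<and> ennreal r < c} = {0..}"
    by auto
  moreover have "emeasure lborel {0::real..} = \<infinity>"
  proof (rule ccontr)
    assume "emeasure lborel {0::real..} \<noteq> \<infinity>"
    then obtain m where m: "emeasure lborel {0::real..} = ennreal m" "m \<ge> 0"
      by (cases "emeasure lborel {0::real..}") auto
    obtain n :: nat where "m < real n" using reals_Archimedean2 by blast
    moreover have "emeasure lborel {0..real n} \<le> emeasure lborel {0::real..}"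
      by (intro emeasure_mono) auto
    ultimately show False using m by simp
  qed
  ultimately show ?thesis using top by simp
qed

subsection \<open>Kernels of the process\<close>

locale pdmp =
  fixes S :: "nat set"
    and a :: "nat \<Rightarrow> nat \<Rightarrow> 'a::euclidean_space \<Rightarrow> real"
    and v :: "nat \<Rightarrow> 'a"
  assumes finite_S: "finite S"
    and continuous_a: "\<And>i j. i \<in> S \<Longrightarrow> j \<in> S \<Longrightarrow> i \<noteq> j \<Longrightarrow> continuous_on UNIV (a i j)"
    and a_nonneg: "\<And>i j l. i \<in> S \<Longrightarrow> j \<in> S \<Longrightarrow> i \<noteq> j \<Longrightarrow> a i j l \<ge> 0"
begin

definition flow :: "real \<Rightarrow> (nat \<Rightarrow> 'a \<Rightarrow> ennreal) \<Rightarrow> nat \<Rightarrow> 'a \<Rightarrow> ennreal" where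
  "flow s f j l = ennreal (pdmp_surv S a v j l s) * f j (l + s *\<^sub>R v j)"

definition jump :: "(nat \<Rightarrow> 'a \<Rightarrow> ennreal) \<Rightarrow> nat \<Rightarrow> 'a \<Rightarrow> ennreal" where
  "jump f j l = (\<Sum>i\<in>S - {j}. ennreal (a j i l) * f i l)"

text \<open>The kernels \<open>pdmp_K\<close>, extended from sets to nonnegative functions: the
  decomposition at the last jump applies them to \<open>jump (flow r f)\<close>, which is no
  indicator.\<close>

primrec kern :: "nat \<Rightarrow> real \<Rightarrow> (nat \<Rightarrow> 'a \<Rightarrow> ennreal) \<Rightarrow> nat \<Rightarrow> 'a \<Rightarrow> ennreal" where
  "kern 0 t f = flow t f"
| "kern (Suc n) t f =
    (\<lambda>j l. \<integral>\<^sup>+ s. indicator {0..t} s * flow s (jump (kern n (t - s) f)) j l \<partial>lborel)"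

definition mean :: "(nat \<Rightarrow> 'a \<Rightarrow> real) \<Rightarrow> (nat \<Rightarrow> 'a \<Rightarrow> ennreal) \<Rightarrow> ennreal" where
  "mean q f = (\<Sum>j\<in>S. \<integral>\<^sup>+ l. ennreal (q j l) * f j l \<partial>lborel)"

text \<open>Joint measurability in parameter and position is what Tonelli asks for. Measurability of
  a single function \<open>f\<close> is expressed by the constant family over
  \<open>lborel\<close>.\<close>

definition measurable_family :: "'m measure \<Rightarrow> ('m \<Rightarrow> nat \<Rightarrow> 'a \<Rightarrow> ennreal) \<Rightarrow> bool" where
  "measurable_family M F \<longleftrightarrow> (\<forall>j\<in>S. (\<lambda>(m, l). F m j l) \<in> borel_measurable (M \<Otimes>\<^sub>M lborel))"

lemma pdmp_K_eq_kern: "pdmp_K S a v n t (j, l) B = kern n t (\<lambda>j l. indicator B (j, l)) j l"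
  by (induction n arbitrary: t j l) (simp_all add: flow_def jump_def mult.assoc)

section \<open>Regularity of the jump rates and of the survival probability\<close>

lemma continuous_rate: "j \<in> S \<Longrightarrow> continuous_on UNIV (pdmp_rate S a j)"
  unfolding pdmp_rate_def by (auto intro!: continuous_on_sum continuous_a)

lemma rate_nonneg: "j \<in> S \<Longrightarrow> pdmp_rate S a j l \<ge> 0"
  unfolding pdmp_rate_def by (auto intro!: sum_nonneg a_nonneg)

lemma continuous_rate_along [continuous_intros]:
  "j \<in> S \<Longrightarrow> continuous_on A x \<Longrightarrow> continuous_on A (\<lambda>z. pdmp_rate S a j (x z))"
  by (rule continuous_on_compose2[OF continuous_rate]) auto

text \<open>Rescaling the time interval to a fixed one turns the survival probability into a parametric
  integral; negative times count as zero, since integrals over empty intervals vanish.\<close>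
lemma surv_eq:
  assumes j: "j \<in> S"
  shows "pdmp_surv S a v j l s =
    exp (- (max 0 s * integral {0..1} (\<lambda>r. pdmp_rate S a j (l + (max 0 s * r) *\<^sub>R v j))))"
proof (cases "s > 0")
  case True
  define h where "h = (\<lambda>u. pdmp_rate S a j (l + u *\<^sub>R v j))"
  have "continuous_on {0..s} h"
    unfolding h_def by (intro continuous_intros j)
  then have "(h has_integral integral {0..s} h) (cbox 0 s)"
    by (auto intro: integrable_integral integrable_continuous_real)
  from has_integral_affinity'[OF this True, of 0] True
  have "((\<lambda>x. h (s * x)) has_integral integral {0..s} h / s) {0..1}"
    by (simp add: divide_inverse mult.commute)
  then have "integral {0..s} h = s * integral {0..1} (\<lambda>x. h (s * x))"
    using True by (simp add: integral_unique)
  with True show ?thesis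
    by (simp add: pdmp_surv_def h_def)
next
  case False
  then show ?thesis
    by (cases "s = 0") (simp_all add: pdmp_surv_def)
qed

lemma continuous_surv:
  assumes j: "j \<in> S"
  shows "continuous_on UNIV (\<lambda>(l, s). pdmp_surv S a v j l s)"
proof -
  have "continuous_on (UNIV \<times> cbox 0 (1::real))
    (\<lambda>(x, r). pdmp_rate S a j (fst x + (max 0 (snd x) * r) *\<^sub>R v j))"
    unfolding split_beta by (intro continuous_intros j)
  then have "continuous_on UNIV (\<lambda>x. integral (cbox 0 (1::real))
    (\<lambda>r. pdmp_rate S a j (fst x + (max 0 (snd x) * r) *\<^sub>R v j)))"
    by (rule integral_continuous_on_param)
  then show ?thesis
    unfolding split_beta surv_eq[OF j] by (auto intro!: continuous_intros)
qed

lemma surv_le_1: "j \<in> S \<Longrightarrow> pdmp_surv S a v j l s \<le> 1"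
  by (auto simp: pdmp_surv_def intro!: integral_nonneg integrable_continuous_real continuous_intros continuous_rate rate_nonneg)

lemma measurable_a [measurable]:
  "j \<in> S \<Longrightarrow> i \<in> S \<Longrightarrow> i \<noteq> j \<Longrightarrow> a j i \<in> borel_measurable borel"
  by (auto intro: borel_measurable_continuous_onI continuous_a)

lemma measurable_surv:
  assumes "j \<in> S" and [measurable]: "x \<in> measurable M borel" "\<tau> \<in> borel_measurable M"
  shows "(\<lambda>m. pdmp_surv S a v j (x m) (\<tau> m)) \<in> borel_measurable M"
proof -
  have "(\<lambda>(l, s). pdmp_surv S a v j l s) \<in> borel_measurable (borel \<Otimes>\<^sub>M borel)"
    using continuous_surv[OF assms(1)] by (simp add: borel_prod borel_measurable_continuous_onI)
  then have "(\<lambda>m. (\<lambda>(l, s). pdmp_surv S a v j l s) (x m, \<tau> m)) \<in> borel_measurable M"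
    by (rule measurable_compose[rotated]) measurable
  then show ?thesis by simp
qed

section \<open>Joint measurability under the operators of the process\<close>

lemma measurable_familyI:
  "(\<And>j. j \<in> S \<Longrightarrow> (\<lambda>(m, l). F m j l) \<in> borel_measurable (M \<Otimes>\<^sub>M lborel)) \<Longrightarrow> measurable_family M F"
  by (simp add: measurable_family_def)

lemma measurable_family_apply:
  assumes "measurable_family M F" "j \<in> S"
    and [measurable]: "\<phi> \<in> measurable N M" "x \<in> measurable N borel"
  shows "(\<lambda>n. F (\<phi> n) j (x n)) \<in> borel_measurable N"
proof -
  have [measurable]: "(\<lambda>(m, l). F m j l) \<in> borel_measurable (M \<Otimes>\<^sub>M lborel)"
    using assms by (simp add: measurable_family_def)
  have "(\<lambda>n. (\<lambda>(m, l). F m j l) (\<phi> n, x n)) \<in> borel_measurable N"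
    by measurable
  then show ?thesis by simp
qed

lemma measurable_family_comp:
  assumes "measurable_family M F" "\<phi> \<in> measurable N M"
  shows "measurable_family N (\<lambda>n. F (\<phi> n))"
  unfolding measurable_family_def split_beta
  by (intro ballI measurable_family_apply[OF assms(1)] measurable_compose[OF measurable_fst assms(2)])
    (auto simp: measurable_lborel1)

lemma measurable_family_jump:
  assumes "measurable_family M F"
  shows "measurable_family M (\<lambda>m. jump (F m))"
  unfolding measurable_family_def split_beta jump_def
proof (intro ballI borel_measurable_sum borel_measurable_times_ennreal)
  fix j i assume *: "j \<in> S" "i \<in> S - {j}"
  then have [measurable]: "a j i \<in> borel_measurable borel" by auto
  show "(\<lambda>x. ennreal (a j i (snd x))) \<in> borel_measurable (M \<Otimes>\<^sub>M lborel)" by measurable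
  show "(\<lambda>x. F (fst x) i (snd x)) \<in> borel_measurable (M \<Otimes>\<^sub>M lborel)"
    using * by (intro measurable_family_apply[OF assms]) auto
qed

lemma measurable_family_flow:
  assumes "measurable_family M F" and [measurable]: "\<tau> \<in> borel_measurable M"
  shows "measurable_family M (\<lambda>m. flow (\<tau> m) (F m))"
  unfolding measurable_family_def split_beta flow_def
proof (intro ballI borel_measurable_times_ennreal)
  fix j assume j: "j \<in> S"
  note [measurable] = measurable_surv[OF j]
  show "(\<lambda>x. ennreal (pdmp_surv S a v j (snd x) (\<tau> (fst x)))) \<in> borel_measurable (M \<Otimes>\<^sub>M lborel)"
    by measurable
  show "(\<lambda>x. F (fst x) j (snd x + \<tau> (fst x) *\<^sub>R v j)) \<in> borel_measurable (M \<Otimes>\<^sub>M lborel)"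
    by (intro measurable_family_apply[OF assms(1) j]) measurable
qed

lemma measurable_family_integral:
  fixes F :: "'m \<Rightarrow> real \<Rightarrow> nat \<Rightarrow> 'a \<Rightarrow> ennreal"
  assumes F: "measurable_family (M \<Otimes>\<^sub>M lborel) (\<lambda>(m, r). F m r)"
  shows "measurable_family M (\<lambda>m j l. \<integral>\<^sup>+ r. F m r j l \<partial>lborel)"
proof (rule measurable_familyI)
  fix j assume j: "j \<in> S"
  have "(\<lambda>z. (\<lambda>(m, r). F m r) (fst (fst z), snd z) j (snd (fst z)))
      \<in> borel_measurable ((M \<Otimes>\<^sub>M lborel) \<Otimes>\<^sub>M (lborel :: real measure))"
    by (intro measurable_family_apply[OF F j]) measurable
  then have "(\<lambda>(x, r). F (fst x) r j (snd x)) \<in> borel_measurable ((M \<Otimes>\<^sub>M lborel) \<Otimes>\<^sub>M lborel)"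
    by (simp add: split_beta')
  from lborel.borel_measurable_nn_integral[OF this]
  show "(\<lambda>(m, l). \<integral>\<^sup>+ r. F m r j l \<partial>lborel) \<in> borel_measurable (M \<Otimes>\<^sub>M lborel)"
    by (simp add: split_beta')
qed

lemma measurable_family_scale:
  assumes "measurable_family M F" and [measurable]: "\<psi> \<in> borel_measurable M"
  shows "measurable_family M (\<lambda>m j l. \<psi> m * F m j l)"
  unfolding measurable_family_def split_beta
  by (intro ballI borel_measurable_times_ennreal measurable_family_apply[OF assms(1)])
    (auto simp: measurable_compose[OF measurable_fst])

text \<open>The recursion evaluates the inner kernel at the moving time \<open>t - s\<close>, so the
  induction only closes with time as a further parameter.\<close>

lemma measurable_family_kern':
  assumes F: "measurable_family M F"
  shows "measurable_family (borel \<Otimes>\<^sub>M M) (\<lambda>(t, m). kern n t (F m))"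
proof (induction n)
  case 0
  have "measurable_family (borel \<Otimes>\<^sub>M M) (\<lambda>x. flow (fst x) (F (snd x)))"
    by (intro measurable_family_flow measurable_family_comp[OF F]) measurable
  then show ?case by (simp add: split_beta')
next
  case (Suc n)
  have "measurable_family ((borel \<Otimes>\<^sub>M M) \<Otimes>\<^sub>M (lborel :: real measure))
     (\<lambda>x. (\<lambda>(t, m). kern n t (F m)) (fst (fst x) - snd x, snd (fst x)))"
    by (rule measurable_family_comp[OF Suc]) measurable
  then have "measurable_family ((borel \<Otimes>\<^sub>M M) \<Otimes>\<^sub>M lborel)
      (\<lambda>x j l. indicator {0..fst (fst x)} (snd x) *
         flow (snd x) (jump (kern n (fst (fst x) - snd x) (F (snd (fst x))))) j l)"
    by (intro measurable_family_scale measurable_family_flow measurable_family_jump) simp_all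
  then have "measurable_family ((borel \<Otimes>\<^sub>M M) \<Otimes>\<^sub>M lborel)
      (\<lambda>(y, s). \<lambda>j l. indicator {0..fst y} s *
         flow s (jump (kern n (fst y - s) (F (snd y)))) j l)"
    by (simp add: split_beta')
  from measurable_family_integral[OF this] show ?case
    by (simp add: split_beta')
qed

lemma measurable_family_kern:
  assumes "measurable_family M F" and [measurable]: "\<tau> \<in> borel_measurable M"
  shows "measurable_family M (\<lambda>m. kern n (\<tau> m) (F m))"
proof -
  have "measurable_family M (\<lambda>m. (\<lambda>(t, m). kern n t (F m)) (\<tau> m, m))"
    by (intro measurable_family_comp[OF measurable_family_kern'[OF assms(1)]]) measurable
  then show ?thesis by simp
qed

lemma measurable_mean:
  assumes F: "measurable_family M F" and [measurable]: "\<And>j. j \<in> S \<Longrightarrow> q j \<in> borel_measurable borel"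
  shows "(\<lambda>m. mean q (F m)) \<in> borel_measurable M"
  unfolding mean_def
proof (intro borel_measurable_sum lborel.borel_measurable_nn_integral)
  fix j assume j: "j \<in> S"
  show "(\<lambda>(m, l). ennreal (q j l) * F m j l) \<in> borel_measurable (M \<Otimes>\<^sub>M lborel)"
    using j F unfolding measurable_family_def split_beta' by (intro borel_measurable_times_ennreal) (auto simp: split_beta')
qed

section \<open>Congruence rules and exchange of the operators with integrals over a
  parameter\<close>

lemma jump_cong: "(\<And>i. i \<in> S \<Longrightarrow> f i l = h i l) \<Longrightarrow> jump f j l = jump h j l"
  by (auto simp: jump_def intro!: sum.cong)

lemma flow_cong: "(\<And>l. f j l = h j l) \<Longrightarrow> flow s f j l = flow s h j l"
  by (simp add: flow_def)

lemma mean_cong: "(\<And>j l. j \<in> S \<Longrightarrow> f j l = h j l) \<Longrightarrow> mean q f = mean q h"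
  by (auto simp: mean_def intro!: sum.cong nn_integral_cong)

lemma measurable_family_slice:
  assumes "measurable_family lborel F" "j \<in> S"
  shows "(\<lambda>r. F r j l) \<in> borel_measurable lborel"
  by (intro measurable_family_apply[OF assms]) auto

lemma jump_nn_integral:
  assumes F: "measurable_family lborel F"
  shows "jump (\<lambda>j l. \<integral>\<^sup>+ r. F r j l \<partial>lborel) j l = (\<integral>\<^sup>+ r. jump (F r) j l \<partial>lborel)"
proof -
  have [measurable]: "(\<lambda>r. F r i l) \<in> borel_measurable lborel" if "i \<in> S" for i
    using measurable_family_slice[OF F that] .
  show ?thesis
    unfolding jump_def by (subst nn_integral_sum) (auto simp: nn_integral_cmult)
qed

lemma flow_nn_integral:
  assumes F: "measurable_family lborel F" and j: "j \<in> S"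
  shows "flow s (\<lambda>j l. \<integral>\<^sup>+ r. F r j l \<partial>lborel) j l = (\<integral>\<^sup>+ r. flow s (F r) j l \<partial>lborel)"
  unfolding flow_def by (subst nn_integral_cmult[OF measurable_family_slice[OF F j]]) simp

lemma mean_nn_integral:
  assumes F: "measurable_family lborel F" and [measurable]: "\<And>j. j \<in> S \<Longrightarrow> q j \<in> borel_measurable borel"
  shows "mean q (\<lambda>j l. \<integral>\<^sup>+ r. F r j l \<partial>lborel) = (\<integral>\<^sup>+ r. mean q (F r) \<partial>lborel)"
proof -
  have m: "(\<lambda>(r, l). ennreal (q j l) * F r j l) \<in> borel_measurable (lborel \<Otimes>\<^sub>M lborel)" if "j \<in> S" for j
    using that F unfolding measurable_family_def split_beta' by (intro borel_measurable_times_ennreal) (auto simp: split_beta')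
  have "mean q (\<lambda>j l. \<integral>\<^sup>+ r. F r j l \<partial>lborel) = (\<Sum>j\<in>S. \<integral>\<^sup>+ l. \<integral>\<^sup>+ r. ennreal (q j l) * F r j l \<partial>lborel \<partial>lborel)"
    unfolding mean_def
    by (intro sum.cong nn_integral_cong nn_integral_cmult[symmetric] measurable_family_slice[OF F]) auto
  also have "\<dots> = (\<Sum>j\<in>S. \<integral>\<^sup>+ r. \<integral>\<^sup>+ l. ennreal (q j l) * F r j l \<partial>lborel \<partial>lborel)"
    by (intro sum.cong lborel_pair.Fubini' m) auto
  also have "\<dots> = (\<integral>\<^sup>+ r. mean q (F r) \<partial>lborel)"
    unfolding mean_def
    by (intro nn_integral_sum[symmetric] lborel.borel_measurable_nn_integral m)
  finally show ?thesis .
qed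

text \<open>Tonelli at each level of the recursion. Agreement of \<open>f\<close> with the integral
  on \<open>S\<close> suffices because a start in \<open>S\<close> only ever reaches modes in
  \<open>S\<close>.\<close>

lemma kern_nn_integral:
  fixes F :: "real \<Rightarrow> nat \<Rightarrow> 'a \<Rightarrow> ennreal"
  assumes F: "measurable_family lborel F"
    and f: "\<And>j l. j \<in> S \<Longrightarrow> f j l = (\<integral>\<^sup>+ r. F r j l \<partial>lborel)"
  shows "j \<in> S \<Longrightarrow> kern n t f j l = (\<integral>\<^sup>+ r. kern n t (F r) j l \<partial>lborel)"
proof (induction n arbitrary: t j l)
  case 0
  then have "kern 0 t f j l = flow t (\<lambda>j l. \<integral>\<^sup>+ r. F r j l \<partial>lborel) j l"
    using f by (simp add: flow_def)
  then show ?case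
    using flow_nn_integral[OF F 0] by simp
next
  case (Suc n)
  note mK = measurable_family_kern[OF F]
  have m: "(\<lambda>(s, r). indicator {0..t} s * flow s (jump (kern n (t - s) (F r))) j l)
      \<in> borel_measurable (lborel \<Otimes>\<^sub>M (lborel :: real measure))"
  proof -
    have "measurable_family (lborel \<Otimes>\<^sub>M (lborel :: real measure))
       (\<lambda>x. flow (fst x) (jump (kern n (t - fst x) (F (snd x)))))"
      by (intro measurable_family_flow measurable_family_jump measurable_family_kern
          measurable_family_comp[OF F]) measurable
    from measurable_family_apply[OF this Suc.prems measurable_ident_sets[OF refl], of "\<lambda>_. l"]
    show ?thesis unfolding split_beta' by (intro borel_measurable_times_ennreal) auto
  qed
  have "kern (Suc n) t f j l = (\<integral>\<^sup>+ s. indicator {0..t} s *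
      flow s (\<lambda>j l. \<integral>\<^sup>+ r. jump (kern n (t - s) (F r)) j l \<partial>lborel) j l \<partial>lborel)"
    using Suc.IH by (simp add: jump_nn_integral[OF mK, symmetric] cong: flow_cong jump_cong)
  also have "\<dots> = (\<integral>\<^sup>+ s. \<integral>\<^sup>+ r. indicator {0..t} s * flow s (jump (kern n (t - s) (F r))) j l \<partial>lborel \<partial>lborel)"
  proof (rule nn_integral_cong)
    fix s :: real
    have mJ: "measurable_family lborel (\<lambda>r. jump (kern n (t - s) (F r)))"
      by (intro measurable_family_jump mK) measurable
    have mU: "measurable_family lborel (\<lambda>r. flow s (jump (kern n (t - s) (F r))))"
      by (intro measurable_family_flow mJ) measurable
    show "indicator {0..t} s * flow s (\<lambda>j l. \<integral>\<^sup>+ r. jump (kern n (t - s) (F r)) j l \<partial>lborel) j l =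
      (\<integral>\<^sup>+ r. indicator {0..t} s * flow s (jump (kern n (t - s) (F r))) j l \<partial>lborel)"
      by (simp add: flow_nn_integral[OF mJ Suc.prems]
          nn_integral_cmult[OF measurable_family_slice[OF mU Suc.prems]])
  qed
  also have "\<dots> = (\<integral>\<^sup>+ r. kern (Suc n) t (F r) j l \<partial>lborel)"
    using lborel_pair.Fubini'[OF m] by simp
  finally show ?case .
qed

text \<open>\<open>kern\<close> is defined by splitting at the first jump; here \<open>r\<close> is
  the time elapsed since the last one. The induction peels off the first jump at time
  \<open>s\<close>, splits the rest by the induction hypothesis, and exchanges the integrals over
  \<open>s\<close> and \<open>r\<close>.\<close>

lemma kern_last_jump:
  assumes f: "measurable_family lborel (\<lambda>_::real. f)"
  shows "j \<in> S \<Longrightarrow> kern (Suc n) t f j l =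
    (\<integral>\<^sup>+ r. indicator {0..t} r * kern n (t - r) (jump (flow r f)) j l \<partial>lborel)"
proof (induction n arbitrary: t j l)
  case 0
  \<comment> \<open>A single jump is both first and last; only its time is measured from the other
    end of \<open>{0..t}\<close>.\<close>
  have "measurable_family lborel (\<lambda>r. flow r (jump (flow (t - r) f)))"
    by (intro measurable_family_flow measurable_family_jump f) measurable
  from nn_integral_reflect[OF measurable_family_slice[OF this 0], of t l]
  show ?case by simp
next
  case (Suc n)
  let ?H = "\<lambda>s r. flow s (jump (kern n (t - s - r) (jump (flow r f)))) j l"
  have mf: "measurable_family M (\<lambda>_. f)" for M :: "'m measure"
    using measurable_family_comp[OF f, of "\<lambda>_. 0" M] by simp
  have m: "(\<lambda>(s, r). ?H s r) \<in> borel_measurable (lborel \<Otimes>\<^sub>M (lborel :: real measure))"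
  proof -
    have "measurable_family (lborel \<Otimes>\<^sub>M (lborel :: real measure))
       (\<lambda>x. flow (fst x) (jump (kern n (t - fst x - snd x) (jump (flow (snd x) f)))))"
      by (intro measurable_family_flow measurable_family_jump measurable_family_kern mf) measurable
    from measurable_family_apply[OF this Suc.prems measurable_ident_sets[OF refl], of "\<lambda>_. l"]
    show ?thesis unfolding split_beta' by auto
  qed
  have "kern (Suc (Suc n)) t f j l = (\<integral>\<^sup>+ s. indicator {0..t} s *
     (\<integral>\<^sup>+ r. indicator {0..t - s} r * ?H s r \<partial>lborel) \<partial>lborel)"
    unfolding kern.simps(2)[of "Suc n"]
  proof (rule nn_integral_cong)
    fix s :: real
    let ?G = "\<lambda>r j l. indicator {0..t - s} r * kern n (t - s - r) (jump (flow r f)) j l"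
    have mG: "measurable_family lborel ?G"
      by (intro measurable_family_scale measurable_family_kern measurable_family_jump measurable_family_flow f) measurable
    have "flow s (jump (kern (Suc n) (t - s) f)) j l = flow s (jump (\<lambda>j l. \<integral>\<^sup>+ r. ?G r j l \<partial>lborel)) j l"
      using Suc.IH by (intro flow_cong jump_cong) simp
    also have "\<dots> = flow s (\<lambda>j l. \<integral>\<^sup>+ r. jump (?G r) j l \<partial>lborel) j l"
      by (intro flow_cong jump_nn_integral mG)
    also have "\<dots> = (\<integral>\<^sup>+ r. flow s (jump (?G r)) j l \<partial>lborel)"
      by (intro flow_nn_integral measurable_family_jump mG Suc.prems)
    also have "\<dots> = (\<integral>\<^sup>+ r. indicator {0..t - s} r * ?H s r \<partial>lborel)"
      by (intro nn_integral_cong) (simp add: flow_def jump_def sum_distrib_left mult_ac)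
    finally show "indicator {0..t} s * flow s (jump (kern (Suc n) (t - s) f)) j l =
      indicator {0..t} s * (\<integral>\<^sup>+ r. indicator {0..t - s} r * ?H s r \<partial>lborel)" by simp
  qed
  also have "\<dots> = (\<integral>\<^sup>+ r. indicator {0..t} r *
     (\<integral>\<^sup>+ s. indicator {0..t - r} s * ?H s r \<partial>lborel) \<partial>lborel)"
    by (rule nn_integral_triangle_swap[OF m])
  also have "\<dots> = (\<integral>\<^sup>+ r. indicator {0..t} r * kern (Suc n) (t - r) (jump (flow r f)) j l \<partial>lborel)"
    by (simp add: algebra_simps)
  finally show ?case .
qed

lemma mean_suminf:
  assumes F: "\<And>n. measurable_family (lborel :: real measure) (\<lambda>_. F n)"
    and q: "\<And>j. j \<in> S \<Longrightarrow> q j \<in> borel_measurable borel"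
  shows "mean q (\<lambda>j l. \<Sum>n. F n j l) = (\<Sum>n. mean q (F n))"
proof -
  have [measurable]: "F n j \<in> borel_measurable borel" if "j \<in> S" for n j
    using measurable_family_apply[OF F that, of "\<lambda>_. 0" borel "\<lambda>x. x"] by simp
  note [measurable] = q
  have "mean q (\<lambda>j l. \<Sum>n. F n j l) = (\<Sum>j\<in>S. \<Sum>n. \<integral>\<^sup>+ l. ennreal (q j l) * F n j l \<partial>lborel)"
    unfolding mean_def ennreal_suminf_cmult[symmetric]
    by (intro sum.cong nn_integral_suminf) auto
  also have "\<dots> = (\<Sum>n. mean q (F n))"
    unfolding mean_def by (intro suminf_sum[symmetric]) auto
  finally show ?thesis .
qed

lemma measurable_family_const:
  "measurable_family (lborel :: real measure) (\<lambda>_. f) \<Longrightarrow> measurable_family M (\<lambda>_. f)"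
  using measurable_family_comp[of lborel "\<lambda>_. f" "\<lambda>_. 0" M] by simp

lemma measurable_family_indicator:
  assumes B: "B \<in> sets (count_space UNIV \<Otimes>\<^sub>M borel)"
  shows "measurable_family M (\<lambda>_ j l. indicator B (j, l))"
proof (rule measurable_familyI)
  fix j :: nat
  have "(\<lambda>z. (j, snd z)) \<in> (M \<Otimes>\<^sub>M (lborel :: 'a measure)) \<rightarrow>\<^sub>M (count_space UNIV \<Otimes>\<^sub>M borel)"
    by (intro measurable_Pair) auto
  from measurable_compose[OF this borel_measurable_indicator[OF B]]
  show "(\<lambda>(m, l). indicator B (j, l) :: ennreal) \<in> borel_measurable (M \<Otimes>\<^sub>M lborel)"
    by (simp add: split_beta')
qed

text \<open>A Poisson bound: at jump rates up to \<open>C\<close>, having \<open>n\<close> jumps by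
  time \<open>s\<close> costs at most \<open>(C * s) ^ n / fact n\<close>, and the outer
  \<open>jump\<close> adds a factor \<open>C\<close>. Speeds are at most \<open>V\<close>, so a path
  that ends in \<open>cball 0 R\<close> starts in \<open>cball 0 (R + s * V)\<close>. Hence only
  rates in the ball of radius \<open>R + t * V\<close> enter.\<close>

lemma kern_bound:
  assumes v: "\<And>j. j \<in> S \<Longrightarrow> norm (v j) \<le> V" and "V \<ge> 0"
    and C: "\<And>j l. j \<in> S \<Longrightarrow> norm l \<le> R + t * V \<Longrightarrow> pdmp_rate S a j l \<le> C" and "C \<ge> 0"
    and f: "\<And>j l. j \<in> S \<Longrightarrow> f j l \<le> indicator (cball 0 R) l"
    and s: "j \<in> S" "0 \<le> s" "s \<le> t"
  shows "jump (kern n s f) j l \<le> ennreal (C * ((C * s) ^ n / fact n)) * indicator (cball 0 (R + s * V)) l"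
proof -
  \<comment> \<open>The rates out of \<open>j\<close> add up to \<open>pdmp_rate S a j l\<close>,
    which is at most \<open>C\<close> on the ball; off the ball both sides vanish.\<close>
  have J: "jump h j l \<le> ennreal (C * c) * indicator (cball 0 (R + s * V)) l"
    if j: "j \<in> S" and h: "\<And>j. j \<in> S \<Longrightarrow> h j l \<le> ennreal c * indicator (cball 0 (R + s * V)) l"
      and s: "s \<le> t" and c: "c \<ge> 0" for h j l c s
  proof -
    have "jump h j l \<le> (\<Sum>i\<in>S - {j}. ennreal (a j i l) * (ennreal c * indicator (cball 0 (R + s * V)) l))"
      unfolding jump_def by (intro sum_mono mult_left_mono h) auto
    also have "\<dots> = ennreal (pdmp_rate S a j l) * (ennreal c * indicator (cball 0 (R + s * V)) l)"
      using j unfolding pdmp_rate_def sum_distrib_right[symmetric]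
      by (subst sum_ennreal) (auto intro: a_nonneg)
    also have "\<dots> \<le> ennreal (C * c) * indicator (cball 0 (R + s * V)) l"
    proof (cases "l \<in> cball 0 (R + s * V)")
      case True
      then have "norm l \<le> R + t * V"
        using mult_right_mono[OF s \<open>V \<ge> 0\<close>] by simp
      from C[OF j this] True \<open>C \<ge> 0\<close> c show ?thesis
        by (auto simp: ennreal_mult intro!: mult_right_mono ennreal_leI)
    qed auto
    finally show ?thesis .
  qed
  have K: "kern n s f j l \<le> ennreal ((C * s) ^ n / fact n) * indicator (cball 0 (R + s * V)) l"
    if "j \<in> S" "0 \<le> s" "s \<le> t" for n s j l
    using that
  proof (induction n arbitrary: s j l)
    case 0
    have le: "norm l \<le> R + s * V" if "norm (l + s *\<^sub>R v j) \<le> R"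
    proof -
      have "norm l \<le> norm (l + s *\<^sub>R v j) + norm (s *\<^sub>R v j)"
        using norm_triangle_ineq4[of "l + s *\<^sub>R v j" "s *\<^sub>R v j"] by simp
      also have "norm (s *\<^sub>R v j) \<le> s * V"
        using 0 v by (simp add: mult_left_mono)
      finally show ?thesis using that by simp
    qed
    have "kern 0 s f j l \<le> 1 * indicator (cball 0 R) (l + s *\<^sub>R v j)"
      unfolding kern.simps flow_def using 0 surv_le_1 f
      by (intro mult_mono) (auto simp: ennreal_le_1)
    also have "\<dots> \<le> indicator (cball 0 (R + s * V)) l"
      using le by (auto split: split_indicator)
    finally show ?case by simp
  next
    case (Suc n)
    have "kern (Suc n) s f j l \<le> (\<integral>\<^sup>+ r. ennreal (C * ((C * (s - r)) ^ n / fact n)) * indicator {0..s} r *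
        indicator (cball 0 (R + s * V)) l \<partial>lborel)"
      unfolding kern.simps
    proof (rule nn_integral_mono)
      fix r :: real
      show "indicator {0..s} r * flow r (jump (kern n (s - r) f)) j l \<le>
        ennreal (C * ((C * (s - r)) ^ n / fact n)) * indicator {0..s} r * indicator (cball 0 (R + s * V)) l"
      proof (cases "r \<in> {0..s}")
        case True
        let ?x = "l + r *\<^sub>R v j"
        \<comment> \<open>The first jump happens at \<open>?x\<close> with time \<open>s - r\<close>
          left; going back along the flow for time \<open>r\<close> enlarges the radius by at most
          \<open>r * V\<close>.\<close>
        have "norm l \<le> R + s * V" if "norm ?x \<le> R + (s - r) * V"
        proof -
          have "norm l \<le> norm ?x + norm (r *\<^sub>R v j)"
            using norm_triangle_ineq4[of "l + r *\<^sub>R v j" "r *\<^sub>R v j"] by simp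
          also have "norm (r *\<^sub>R v j) \<le> r * V"
            using True v Suc.prems by (simp add: mult_left_mono)
          finally show ?thesis using that by (simp add: algebra_simps)
        qed
        then have ind: "indicator (cball 0 (R + (s - r) * V)) ?x \<le> (indicator (cball 0 (R + s * V)) l :: ennreal)"
          by (auto split: split_indicator)
        have "jump (kern n (s - r) f) j ?x \<le> ennreal (C * ((C * (s - r)) ^ n / fact n)) *
            indicator (cball 0 (R + (s - r) * V)) ?x"
          using Suc True \<open>C \<ge> 0\<close> by (intro J) auto
        then have "flow r (jump (kern n (s - r) f)) j l \<le> 1 * (ennreal (C * ((C * (s - r)) ^ n / fact n)) *
            indicator (cball 0 (R + (s - r) * V)) ?x)"
          unfolding flow_def using Suc.prems surv_le_1 by (intro mult_mono) (auto simp: ennreal_le_1)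
        also have "\<dots> \<le> ennreal (C * ((C * (s - r)) ^ n / fact n)) * indicator (cball 0 (R + s * V)) l"
          using ind by (auto intro: mult_left_mono)
        finally show ?thesis using True by simp
      qed auto
    qed
    also have "\<dots> = (\<integral>\<^sup>+ r. ennreal (C * ((C * (s - r)) ^ n / fact n)) * indicator {0..s} r \<partial>lborel) *
        indicator (cball 0 (R + s * V)) l"
      by (intro nn_integral_multc) measurable
    \<comment> \<open>The antiderivative vanishes at \<open>r = s\<close>, and its value at
      \<open>r = 0\<close> supplies the next Poisson term.\<close>
    also have "(\<integral>\<^sup>+ r. ennreal (C * ((C * (s - r)) ^ n / fact n)) * indicator {0..s} r \<partial>lborel) =
        ennreal (- ((C * (s - s)) ^ Suc n / fact (Suc n)) - - ((C * (s - 0)) ^ Suc n / fact (Suc n)))"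
    proof (rule nn_integral_FTC_Icc)
      fix r
      have "((\<lambda>r. C * (s - r)) has_real_derivative - C) (at r)"
        by (auto intro!: derivative_eq_intros)
      from DERIV_minus[OF DERIV_cdivide[OF DERIV_power[OF this, of "Suc n"], of "fact (Suc n)"]]
      show "((\<lambda>r. - ((C * (s - r)) ^ Suc n / fact (Suc n))) has_real_derivative
          C * ((C * (s - r)) ^ n / fact n)) (at r)"
        by (rule DERIV_cong) (simp add: divide_simps)
    qed (use Suc.prems \<open>C \<ge> 0\<close> in auto)
    finally show ?case by simp
  qed
  show ?thesis
    using s \<open>C \<ge> 0\<close> by (intro J K) auto
qed

lemma rate_bounded:
  obtains C where "C \<ge> 0" "\<And>j l. j \<in> S \<Longrightarrow> norm l \<le> \<rho> \<Longrightarrow> pdmp_rate S a j l \<le> C"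
proof -
  have "\<exists>c. \<forall>l\<in>cball 0 \<rho>. pdmp_rate S a j l \<le> c" if "j \<in> S" for j
  proof -
    have "compact (pdmp_rate S a j ` cball 0 \<rho>)"
      by (intro compact_continuous_image continuous_on_subset[OF continuous_rate[OF that]]) auto
    then have "bdd_above (pdmp_rate S a j ` cball 0 \<rho>)"
      by (intro bounded_imp_bdd_above compact_imp_bounded)
    then show ?thesis
      by (simp add: bdd_above_def)
  qed
  then have "\<forall>j\<in>S. \<exists>c. \<forall>l\<in>cball 0 \<rho>. pdmp_rate S a j l \<le> c" by blast
  from bchoice[OF this] obtain c where
    c: "\<And>j l. j \<in> S \<Longrightarrow> l \<in> cball 0 \<rho> \<Longrightarrow> pdmp_rate S a j l \<le> c j"
    by blast
  show thesis
  proof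
    \<comment> \<open>Compactness bounds each mode separately; the sum of absolute values dominates
      all these bounds at once.\<close>
    show "(\<Sum>j\<in>S. \<bar>c j\<bar>) \<ge> 0" by (simp add: sum_nonneg)
    fix j and l :: 'a assume j: "j \<in> S" and l: "norm l \<le> \<rho>"
    have "pdmp_rate S a j l \<le> \<bar>c j\<bar>" using c[OF j, of l] l by simp
    also have "\<dots> \<le> (\<Sum>j\<in>S. \<bar>c j\<bar>)" by (rule member_le_sum[OF j]) (auto simp: finite_S)
    finally show "pdmp_rate S a j l \<le> (\<Sum>j\<in>S. \<bar>c j\<bar>)" .
  qed
qed

subsection \<open>Transport of densities\<close>

text \<open>The adjoint of \<open>jump\<close>, acting on densities; see
  \<open>mean_jump\<close>.\<close>

definition influx :: "(nat \<Rightarrow> 'a \<Rightarrow> real) \<Rightarrow> nat \<Rightarrow> 'a \<Rightarrow> real" where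
  "influx q j l = (\<Sum>i\<in>S - {j}. q i l * a i j l)"

text \<open>The density at time \<open>t\<close> of the mass that starts with density \<open>q\<close> and survives, plus the
  mass that jumps during \<open>[0, t]\<close> at the rate prescribed by the frozen density \<open>q\<close> and survives
  afterwards.\<close>
definition transport :: "real \<Rightarrow> (nat \<Rightarrow> 'a \<Rightarrow> real) \<Rightarrow> nat \<Rightarrow> 'a \<Rightarrow> real" where
  "transport t q j l = q j (l - t *\<^sub>R v j) * pdmp_surv S a v j (l - t *\<^sub>R v j) t +
     integral {0..t} (\<lambda>s. influx q j (l - s *\<^sub>R v j) * pdmp_surv S a v j (l - s *\<^sub>R v j) s)"

section \<open>Adjoints of the flow and the jump operator\<close>

lemma continuous_surv_compose [continuous_intros]:
  assumes "j \<in> S" "continuous_on A x" "continuous_on A \<tau>"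
  shows "continuous_on A (\<lambda>z. pdmp_surv S a v j (x z) (\<tau> z))"
  using continuous_on_compose2[OF continuous_surv[OF assms(1)] continuous_on_Pair[OF assms(2,3)]] by simp

lemma continuous_a_compose [continuous_intros]:
  assumes "i \<in> S" "j \<in> S" "i \<noteq> j" "continuous_on A x"
  shows "continuous_on A (\<lambda>z. a i j (x z))"
  by (rule continuous_on_compose2[OF continuous_a]) (use assms in auto)

text \<open>Reading the path backwards from its endpoint \<open>l\<close>, by
  \<open>u \<mapsto> s - u\<close>, leaves \<open>s\<close> only as the upper limit of integration.
  The fundamental theorem then differentiates the survival probability with merely continuous
  rates.\<close>

lemma surv_reflect:
  assumes j: "j \<in> S"
  shows "pdmp_surv S a v j (l - s *\<^sub>R v j) s = exp (- integral {0..s} (\<lambda>u. pdmp_rate S a j (l - u *\<^sub>R v j)))"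
proof -
  let ?h = "\<lambda>u. pdmp_rate S a j (l - u *\<^sub>R v j)"
  have "integral {0..s} (\<lambda>u. pdmp_rate S a j (l - s *\<^sub>R v j + u *\<^sub>R v j)) = integral {0..s} (\<lambda>u. ?h (s - u))"
    by (simp add: algebra_simps)
  also have "\<dots> = integral {-s..0} ((\<lambda>u. ?h (s + u)))"
    using Henstock_Kurzweil_Integration.integral_reflect_real[of 0 "-s" "\<lambda>u. ?h (s + u)"] by simp
  also have "\<dots> = integral {0..s} ?h"
    using integral_shift_Icc_real[of "-s" 0 ?h s] by (simp add: o_def add.commute)
  finally show ?thesis by (simp add: pdmp_surv_def)
qed

text \<open>Translation invariance of Lebesgue measure, with the endpoint of the motion as the new
  variable, moves the flow from \<open>f\<close> to the density.\<close>

lemma mean_flow: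
  assumes q_measurable: "\<And>j. j \<in> S \<Longrightarrow> q j \<in> borel_measurable borel"
    and q_nonneg: "\<And>j l. j \<in> S \<Longrightarrow> q j l \<ge> 0"
    and f: "measurable_family lborel (\<lambda>_::real. f)"
  shows "mean q (flow t f) =
    (\<Sum>j\<in>S. \<integral>\<^sup>+ l. ennreal (q j (l - t *\<^sub>R v j) * pdmp_surv S a v j (l - t *\<^sub>R v j) t) * f j l \<partial>lborel)"
  unfolding mean_def
proof (rule sum.cong[OF refl])
  fix j assume j: "j \<in> S"
  note [measurable] = measurable_surv[OF j] q_measurable[OF j]
  have [measurable]: "f j \<in> borel_measurable borel"
    using measurable_family_apply[OF f j, of "\<lambda>_. 0" borel "\<lambda>x. x"] by simp
  let ?g = "\<lambda>l. ennreal (q j (l - t *\<^sub>R v j) * pdmp_surv S a v j (l - t *\<^sub>R v j) t) * f j l"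
  have "?g \<in> borel_measurable lborel" by measurable
  from nn_integral_lborel_shift[OF this, of "t *\<^sub>R v j"]
  show "(\<integral>\<^sup>+ l. ennreal (q j l) * flow t f j l \<partial>lborel) = (\<integral>\<^sup>+ l. ?g l \<partial>lborel)"
    using q_nonneg[OF j] by (simp add: flow_def ennreal_mult' mult.assoc)
qed

text \<open>Exchanging the two sums over ordered pairs of distinct modes turns outgoing jumps tested
  against \<open>f\<close> into incoming ones weighted by \<open>q\<close>.\<close>

lemma mean_jump:
  assumes q_measurable: "\<And>j. j \<in> S \<Longrightarrow> q j \<in> borel_measurable borel"
    and q_nonneg: "\<And>j l. j \<in> S \<Longrightarrow> q j l \<ge> 0"
    and f: "measurable_family lborel (\<lambda>_::real. f)"
  shows "mean q (jump f) = mean (influx q) f"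
proof -
  have [measurable]: "f j \<in> borel_measurable borel" if "j \<in> S" for j
    using measurable_family_apply[OF f that, of "\<lambda>_. 0" borel "\<lambda>x. x"] by simp
  note [measurable] = q_measurable
  let ?I = "\<lambda>j i. \<integral>\<^sup>+ l. ennreal (q j l * a j i l) * f i l \<partial>lborel"
  have "mean q (jump f) = (\<Sum>j\<in>S. \<integral>\<^sup>+ l. (\<Sum>i\<in>S - {j}. ennreal (q j l * a j i l) * f i l) \<partial>lborel)"
    unfolding mean_def jump_def
    by (intro sum.cong nn_integral_cong) (auto simp: sum_distrib_left ennreal_mult' q_nonneg a_nonneg mult.assoc intro!: sum.cong)
  also have "\<dots> = (\<Sum>j\<in>S. \<Sum>i\<in>S - {j}. ?I j i)"
    by (intro sum.cong nn_integral_sum) auto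
  \<comment> \<open>The inner range depends on \<open>j\<close>; written as a relation between
    \<open>j\<close> and \<open>i\<close> it fits \<open>sum.swap_restrict\<close>.\<close>
  also have "\<dots> = (\<Sum>j\<in>S. \<Sum>i | i \<in> S \<and> j \<noteq> i. ?I j i)"
    by (intro sum.cong) auto
  also have "\<dots> = (\<Sum>i\<in>S. \<Sum>j | j \<in> S \<and> j \<noteq> i. ?I j i)"
    by (rule sum.swap_restrict[OF finite_S finite_S])
  also have "\<dots> = (\<Sum>i\<in>S. \<Sum>j\<in>S - {i}. ?I j i)"
    by (intro sum.cong) auto
  also have "\<dots> = (\<Sum>i\<in>S. \<integral>\<^sup>+ l. (\<Sum>j\<in>S - {i}. ennreal (q j l * a j i l) * f i l) \<partial>lborel)"
    by (intro sum.cong nn_integral_sum[symmetric]) auto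
  also have "\<dots> = mean (influx q) f"
    unfolding mean_def influx_def
    by (intro sum.cong nn_integral_cong refl, subst sum_ennreal[symmetric])
       (auto simp: sum_distrib_right q_nonneg a_nonneg)
  finally show ?thesis .
qed

end

locale pdmp_density = pdmp +
  fixes q :: "nat \<Rightarrow> 'a::euclidean_space \<Rightarrow> real"
  assumes q_differentiable: "\<And>j l. j \<in> S \<Longrightarrow> q j differentiable (at l)"
    and q_nonneg: "\<And>j l. j \<in> S \<Longrightarrow> q j l \<ge> 0"
    and q_integrable: "\<And>j. j \<in> S \<Longrightarrow> (\<integral>\<^sup>+ l. ennreal (q j l) \<partial>lborel) < \<infinity>"
begin

lemma q_cont: "j \<in> S \<Longrightarrow> continuous_on UNIV (q j)"
  by (simp add: continuous_at_imp_continuous_on differentiable_imp_continuous_within q_differentiable)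

lemma continuous_q_compose [continuous_intros]:
  "j \<in> S \<Longrightarrow> continuous_on A x \<Longrightarrow> continuous_on A (\<lambda>z. q j (x z))"
  by (rule continuous_on_compose2[OF q_cont]) auto

lemma q_measurable [measurable]: "j \<in> S \<Longrightarrow> q j \<in> borel_measurable borel"
  by (intro borel_measurable_continuous_onI q_cont)

lemma continuous_influx_compose [continuous_intros]:
  "j \<in> S \<Longrightarrow> continuous_on A x \<Longrightarrow> continuous_on A (\<lambda>z. influx q j (x z))"
  unfolding influx_def by (intro continuous_intros) auto

lemma influx_nonneg: "j \<in> S \<Longrightarrow> influx q j l \<ge> 0"
  unfolding influx_def by (intro sum_nonneg mult_nonneg_nonneg q_nonneg a_nonneg) auto

lemma continuous_transport:
  assumes j: "j \<in> S"
  shows "continuous_on UNIV (transport t q j)"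
proof -
  have "continuous_on (UNIV \<times> cbox 0 t)
    (\<lambda>(l, s). influx q j (l - s *\<^sub>R v j) * pdmp_surv S a v j (l - s *\<^sub>R v j) s)"
    unfolding split_beta by (intro continuous_intros j)
  from integral_continuous_on_param[OF this] show ?thesis
    unfolding transport_def by (intro continuous_intros j) simp
qed

lemma transport_nonneg: "j \<in> S \<Longrightarrow> transport t q j l \<ge> 0"
  unfolding transport_def
  by (intro add_nonneg_nonneg mult_nonneg_nonneg integral_nonneg integrable_continuous_real
      continuous_intros q_nonneg influx_nonneg) (auto simp: pdmp_surv_def)

text \<open>Duality: \<open>mean_jump\<close> and \<open>mean_flow\<close> move all operators from
  \<open>f\<close> to the density, and Tonelli takes the time integral inside. The integral identity
  for all \<open>f\<close> thus amounts to \<open>transport t q\<close> and \<open>q\<close> having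
  the same integrals.\<close>

lemma mean_transport:
  assumes f: "measurable_family lborel (\<lambda>_::real. f)"
  shows "mean q (flow t f) + (\<integral>\<^sup>+ s. indicator {0..t} s * mean q (jump (flow s f)) \<partial>lborel) =
    mean (transport t q) f"
proof -
  have [measurable]: "f j \<in> borel_measurable borel" if "j \<in> S" for j
    using measurable_family_apply[OF f that, of "\<lambda>_. 0" borel "\<lambda>x. x"] by simp
  define \<rho> where "\<rho> s j l = influx q j (l - s *\<^sub>R v j) * pdmp_surv S a v j (l - s *\<^sub>R v j) s" for s j l
  define \<gamma> where "\<gamma> j l = q j (l - t *\<^sub>R v j) * pdmp_surv S a v j (l - t *\<^sub>R v j) t" for j l
  have \<rho>_cont: "continuous_on UNIV (\<lambda>(s, l). \<rho> s j l)" if "j \<in> S" for j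
    unfolding \<rho>_def split_beta by (intro continuous_intros that)
  have \<gamma>_cont: "continuous_on UNIV (\<gamma> j)" if "j \<in> S" for j
    unfolding \<gamma>_def by (intro continuous_intros that)
  have nn: "\<rho> s j l \<ge> 0" "\<gamma> j l \<ge> 0" if "j \<in> S" for s j l
    unfolding \<rho>_def \<gamma>_def using that
    by (auto simp: pdmp_surv_def intro!: mult_nonneg_nonneg q_nonneg influx_nonneg)
  have [measurable]: "(\<lambda>(s, l). \<rho> s j l) \<in> borel_measurable (lborel \<Otimes>\<^sub>M lborel)"
     "\<gamma> j \<in> borel_measurable borel" if "j \<in> S" for j
    using \<rho>_cont[OF that] \<gamma>_cont[OF that]
    by (auto simp: lborel_prod intro: borel_measurable_continuous_onI)
  \<comment> \<open>The outer operator acts on the density first: \<open>q\<close> becomes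
    \<open>influx q\<close>, which is then carried along the flow for time \<open>s\<close>.\<close>
  have mJ: "mean q (jump (flow s f)) = (\<Sum>j\<in>S. \<integral>\<^sup>+ l. ennreal (\<rho> s j l) * f j l \<partial>lborel)" for s
  proof -
    have "mean q (jump (flow s f)) = mean (influx q) (flow s f)"
      by (intro mean_jump q_measurable q_nonneg measurable_family_flow f) auto
    also have "\<dots> = (\<Sum>j\<in>S. \<integral>\<^sup>+ l. ennreal (\<rho> s j l) * f j l \<partial>lborel)"
      unfolding \<rho>_def by (intro mean_flow f influx_nonneg borel_measurable_continuous_onI continuous_intros) auto
    finally show ?thesis .
  qed
  have "mean (transport t q) f = (\<Sum>j\<in>S. \<integral>\<^sup>+ l. ennreal (\<gamma> j l) * f j l +
     (\<integral>\<^sup>+ s. indicator {0..t} s * (ennreal (\<rho> s j l) * f j l) \<partial>lborel) \<partial>lborel)"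
    unfolding mean_def
  proof (intro sum.cong nn_integral_cong refl)
    fix j l assume j: "j \<in> S"
    have c: "continuous_on UNIV (\<lambda>s. \<rho> s j l)"
      unfolding \<rho>_def by (intro continuous_intros j)
    then have [measurable]: "(\<lambda>s. \<rho> s j l) \<in> borel_measurable borel"
      by (rule borel_measurable_continuous_onI)
    have hi: "((\<lambda>s. \<rho> s j l) has_integral integral {0..t} (\<lambda>s. \<rho> s j l)) {0..t}"
      by (intro integrable_integral integrable_continuous_real continuous_on_subset[OF c]) auto
    have "ennreal (integral {0..t} (\<lambda>s. \<rho> s j l)) = (\<integral>\<^sup>+ s. indicator {0..t} s * ennreal (\<rho> s j l) \<partial>lborel)"
      using nn_integral_has_integral_lebesgue[OF nn(1)[OF j] hi]
      by (simp add: ennreal_mult' ennreal_indicator)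
    moreover have "transport t q j l = \<gamma> j l + integral {0..t} (\<lambda>s. \<rho> s j l)"
      unfolding transport_def \<gamma>_def \<rho>_def by simp
    moreover have "integral {0..t} (\<lambda>s. \<rho> s j l) \<ge> 0"
      by (intro integral_nonneg has_integral_integrable[OF hi] nn j)
    ultimately show "ennreal (transport t q j l) * f j l = ennreal (\<gamma> j l) * f j l +
        (\<integral>\<^sup>+ s. indicator {0..t} s * (ennreal (\<rho> s j l) * f j l) \<partial>lborel)"
      by (simp add: nn[OF j] distrib_right nn_integral_multc[symmetric] mult.assoc)
  qed
  also have "\<dots> = (\<Sum>j\<in>S. (\<integral>\<^sup>+ l. ennreal (\<gamma> j l) * f j l \<partial>lborel) +
     (\<integral>\<^sup>+ s. indicator {0..t} s * (\<integral>\<^sup>+ l. ennreal (\<rho> s j l) * f j l \<partial>lborel) \<partial>lborel))"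
  proof (rule sum.cong[OF refl])
    fix j assume j: "j \<in> S"
    then have [measurable]: "(\<lambda>(s, l). \<rho> s j l) \<in> borel_measurable (lborel \<Otimes>\<^sub>M lborel)" by simp
    have m: "(\<lambda>(s, l). indicator {0..t} s * (ennreal (\<rho> s j l) * f j l)) \<in> borel_measurable (lborel \<Otimes>\<^sub>M lborel)"
      using j by measurable
    have "(\<integral>\<^sup>+ l. ennreal (\<gamma> j l) * f j l + (\<integral>\<^sup>+ s. indicator {0..t} s * (ennreal (\<rho> s j l) * f j l) \<partial>lborel) \<partial>lborel) =
      (\<integral>\<^sup>+ l. ennreal (\<gamma> j l) * f j l \<partial>lborel) + (\<integral>\<^sup>+ l. \<integral>\<^sup>+ s. indicator {0..t} s * (ennreal (\<rho> s j l) * f j l) \<partial>lborel \<partial>lborel)"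
      using j by (intro nn_integral_add) measurable
    also have "(\<integral>\<^sup>+ l. \<integral>\<^sup>+ s. indicator {0..t} s * (ennreal (\<rho> s j l) * f j l) \<partial>lborel \<partial>lborel) =
      (\<integral>\<^sup>+ s. \<integral>\<^sup>+ l. indicator {0..t} s * (ennreal (\<rho> s j l) * f j l) \<partial>lborel \<partial>lborel)"
      by (rule lborel_pair.Fubini'[OF m])
    also have "\<dots> = (\<integral>\<^sup>+ s. indicator {0..t} s * (\<integral>\<^sup>+ l. ennreal (\<rho> s j l) * f j l \<partial>lborel) \<partial>lborel)"
      using j by (intro nn_integral_cong nn_integral_cmult) measurable
    finally show "(\<integral>\<^sup>+ l. ennreal (\<gamma> j l) * f j l + (\<integral>\<^sup>+ s. indicator {0..t} s * (ennreal (\<rho> s j l) * f j l) \<partial>lborel) \<partial>lborel) =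
      (\<integral>\<^sup>+ l. ennreal (\<gamma> j l) * f j l \<partial>lborel) +
      (\<integral>\<^sup>+ s. indicator {0..t} s * (\<integral>\<^sup>+ l. ennreal (\<rho> s j l) * f j l \<partial>lborel) \<partial>lborel)" .
  qed
  also have "\<dots> = mean q (flow t f) + (\<Sum>j\<in>S. \<integral>\<^sup>+ s. indicator {0..t} s * (\<integral>\<^sup>+ l. ennreal (\<rho> s j l) * f j l \<partial>lborel) \<partial>lborel)"
    by (simp add: sum.distrib mean_flow[OF q_measurable q_nonneg f] \<gamma>_def)
  also have "(\<Sum>j\<in>S. \<integral>\<^sup>+ s. indicator {0..t} s * (\<integral>\<^sup>+ l. ennreal (\<rho> s j l) * f j l \<partial>lborel) \<partial>lborel) =
     (\<integral>\<^sup>+ s. indicator {0..t} s * mean q (jump (flow s f)) \<partial>lborel)"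
    unfolding mJ sum_distrib_left
    by (intro nn_integral_sum[symmetric]) measurable
  finally show ?thesis ..
qed

text \<open>The stationary equation says that along each characteristic \<open>s \<mapsto> l - s v j\<close> the surviving
  part of \<open>q j\<close> decreases exactly by the surviving influx.\<close>
lemma transport_characteristic:
  assumes j: "j \<in> S" and s: "s \<in> {0..b}"
  shows "((\<lambda>s. transport s q j l) has_real_derivative
     (let x = l - s *\<^sub>R v j in
      (- frechet_derivative (q j) (at x) (v j) - pdmp_rate S a j x * q j x + influx q j x)
        * pdmp_surv S a v j x s)) (at s within {0..b})"
proof -
  let ?x = "l - s *\<^sub>R v j"
  let ?D = "frechet_derivative (q j) (at ?x)"
  have lin: "linear ?D"
    \<comment> \<open>Linearity of \<open>?D\<close> is used to pull the scalar \<open>h\<close> and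
      the minus sign of the backward direction out of it.\<close>
    using frechet_derivative_works[of "q j" "at ?x"] q_differentiable[OF j] by (auto intro: has_derivative_linear)
  have "((\<lambda>s. l - s *\<^sub>R v j) has_derivative (\<lambda>h. - (h *\<^sub>R v j))) (at s within {0..b})"
    by (auto intro!: derivative_eq_intros)
  moreover have "(q j has_derivative ?D) (at ?x)"
    using q_differentiable[OF j] frechet_derivative_works by blast
  ultimately have "((\<lambda>s. q j (l - s *\<^sub>R v j)) has_derivative (\<lambda>h. ?D (- (h *\<^sub>R v j)))) (at s within {0..b})"
    by (rule has_derivative_compose)
  moreover have "(\<lambda>h. ?D (- (h *\<^sub>R v j))) = (*) (- ?D (v j))"
    using lin by (auto simp: linear_neg linear_scale)
  ultimately have d1: "((\<lambda>s. q j (l - s *\<^sub>R v j)) has_real_derivative - ?D (v j)) (at s within {0..b})"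
    by (simp add: has_field_derivative_def)
  have "((\<lambda>s. integral {0..s} (\<lambda>u. pdmp_rate S a j (l - u *\<^sub>R v j))) has_real_derivative
      pdmp_rate S a j ?x) (at s within {0..b})"
    by (intro integral_has_real_derivative continuous_intros j s)
  then have d2: "((\<lambda>s. pdmp_surv S a v j (l - s *\<^sub>R v j) s) has_real_derivative
      - pdmp_rate S a j ?x * pdmp_surv S a v j ?x s) (at s within {0..b})"
    unfolding surv_reflect[OF j] by (auto intro!: derivative_eq_intros)
  have d3: "((\<lambda>s. integral {0..s} (\<lambda>s. influx q j (l - s *\<^sub>R v j) * pdmp_surv S a v j (l - s *\<^sub>R v j) s))
      has_real_derivative influx q j ?x * pdmp_surv S a v j ?x s) (at s within {0..b})"
    by (rule integral_has_real_derivative) (intro continuous_intros j s)+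
  show ?thesis
    unfolding transport_def Let_def
    by (rule DERIV_cong[OF DERIV_add[OF DERIV_mult[OF d1 d2] d3]]) (simp add: algebra_simps)
qed

text \<open>Under the stationary equation the derivative along every characteristic is zero, so
  \<open>transport\<close> keeps its value at time \<open>0\<close>, which is \<open>q\<close>.
  Conversely, a constant \<open>transport\<close> has zero derivative at time \<open>0\<close>, and
  there the characteristic is at \<open>l\<close> itself with survival weight one.\<close>

lemma transport_fixed_iff:
  shows "(\<forall>t\<ge>0. \<forall>j\<in>S. \<forall>l. transport t q j l = q j l) \<longleftrightarrow>
    (\<forall>j\<in>S. \<forall>l. - frechet_derivative (q j) (at l) (v j) +
        (\<Sum>i\<in>S - {j}. q i l * a i j l - q j l * a j i l) = 0)" (is "?L \<longleftrightarrow> ?R")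
proof -
  note deriv = transport_characteristic
  have sum: "(\<Sum>i\<in>S - {j}. q i l * a i j l - q j l * a j i l) = influx q j l - pdmp_rate S a j l * q j l" for j l
    by (simp add: influx_def pdmp_rate_def sum_subtractf sum_distrib_left mult.commute)
  have transport_0: "transport 0 q j l = q j l" for j l
    by (simp add: transport_def pdmp_surv_def)
  have "transport t q j l = q j l" if R: ?R and "t \<ge> 0" "j \<in> S" for t j l
  proof -
    have "((\<lambda>s. transport s q j l) has_real_derivative 0) (at s within {0..t})" if "s \<in> {0..t}" for s
      using deriv[OF \<open>j \<in> S\<close> that, of l] R \<open>j \<in> S\<close> unfolding sum Let_def
      by (auto elim!: DERIV_cong simp: algebra_simps)
    then have "transport t q j l = transport 0 q j l"
      using has_field_derivative_zero_constant[of "{0..t}" "\<lambda>s. transport s q j l"] \<open>t \<ge> 0\<close>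
      by (metis atLeastAtMost_iff convex_real_interval(5) order_refl)
    then show ?thesis by (simp add: transport_0)
  qed
  moreover have "- frechet_derivative (q j) (at l) (v j) +
        (\<Sum>i\<in>S - {j}. q i l * a i j l - q j l * a j i l) = 0" if L: ?L and j: "j \<in> S" for j l
  proof -
    have "((\<lambda>s. transport s q j l) has_real_derivative
       (- frechet_derivative (q j) (at l) (v j) - pdmp_rate S a j l * q j l + influx q j l)) (at 0 within {0..1})"
      using deriv[OF j, of 0 1 l] by (simp add: pdmp_surv_def)
    moreover have "((\<lambda>s. transport s q j l) has_real_derivative 0) (at 0 within {0..1})"
      by (rule has_field_derivative_transform_within[of "\<lambda>_. q j l" _ _ _ 1]) (use L j in auto)
    \<comment> \<open>Only a one-sided derivative is available at time \<open>0\<close>; it is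
      unique because \<open>0\<close> is a limit point of \<open>{0..1}\<close>.\<close>
    moreover have "at 0 within {0..1::real} \<noteq> bot"
      by (simp add: at_within_Icc_at_right)
    ultimately show ?thesis
      unfolding sum by (auto dest: has_field_derivative_unique)
  qed
  ultimately show ?thesis by blast
qed

subsection \<open>Invariant densities\<close>

lemma mean_integral:
  fixes F :: "real \<Rightarrow> nat \<Rightarrow> 'a \<Rightarrow> ennreal"
  shows "measurable_family lborel F \<Longrightarrow>
    mean q (\<lambda>j l. \<integral>\<^sup>+ r. F r j l \<partial>lborel) = (\<integral>\<^sup>+ r. mean q (F r) \<partial>lborel)"
  by (rule mean_nn_integral) auto

lemma invariant_iff:
  "pdmp_invariant S a v q \<longleftrightarrow> (\<forall>t\<ge>0. \<forall>B\<in>sets (count_space UNIV \<Otimes>\<^sub>M borel).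
     (\<Sum>n. mean q (kern n t (\<lambda>j l. indicator B (j, l)))) = mean q (\<lambda>j l. indicator B (j, l)))"
proof -
  have "(\<Sum>j\<in>S. \<integral>\<^sup>+ l. ennreal (q j l) * pdmp_P S a v t (j, l) B \<partial>lborel) =
     (\<Sum>n. mean q (kern n t (\<lambda>j l. indicator B (j, l))))"
    if B: "B \<in> sets (count_space UNIV \<Otimes>\<^sub>M borel)" for t B
  proof -
    have "(\<Sum>n. mean q (kern n t (\<lambda>j l. indicator B (j, l)))) =
      mean q (\<lambda>j l. \<Sum>n. kern n t (\<lambda>j l. indicator B (j, l)) j l)"
      by (intro mean_suminf[symmetric] measurable_family_kern measurable_family_indicator B) auto
    then show ?thesis
      by (simp add: mean_def pdmp_P_def pdmp_K_eq_kern)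
  qed
  then show ?thesis
    unfolding pdmp_invariant_def mean_def[of q "\<lambda>j l. indicator _ (j, l)"] by auto
qed

text \<open>Both sides are additive in \<open>f\<close>, so the identity passes to integrals over a
  parameter. It is used with superlevel sets to reach all functions from sets, and with bounded
  windows to reach all sets from bounded ones.\<close>

lemma invariant_nn_integral:
  fixes F :: "real \<Rightarrow> nat \<Rightarrow> 'a \<Rightarrow> ennreal"
  assumes F: "measurable_family lborel F"
    and f: "\<And>j l. j \<in> S \<Longrightarrow> f j l = (\<integral>\<^sup>+ r. F r j l \<partial>lborel)"
    and inv: "\<And>r. (\<Sum>n. mean q (kern n t (F r))) = mean q (F r)"
  shows "(\<Sum>n. mean q (kern n t f)) = mean q f"
proof -
  have mK: "measurable_family lborel (\<lambda>r. kern n t (F r))" for n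
    by (intro measurable_family_kern F) auto
  have "mean q (kern n t f) = (\<integral>\<^sup>+ r. mean q (kern n t (F r)) \<partial>lborel)" for n
    unfolding mean_integral[OF mK, symmetric]
    by (intro mean_cong kern_nn_integral F f)
  moreover have "(\<lambda>r. mean q (kern n t (F r))) \<in> borel_measurable lborel" for n
    by (intro measurable_mean mK) auto
  ultimately have "(\<Sum>n. mean q (kern n t f)) = (\<integral>\<^sup>+ r. (\<Sum>n. mean q (kern n t (F r))) \<partial>lborel)"
    by (simp add: nn_integral_suminf)
  also have "\<dots> = mean q (\<lambda>j l. \<integral>\<^sup>+ r. F r j l \<partial>lborel)"
    by (simp add: inv mean_integral[OF F])
  also have "\<dots> = mean q f"
    by (intro mean_cong f[symmetric])
  finally show ?thesis .
qed

lemma invariant_function: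
  assumes inv: "pdmp_invariant S a v q" and t: "t \<ge> 0"
    and f: "measurable_family lborel (\<lambda>_::real. f)"
  shows "(\<Sum>n. mean q (kern n t f)) = mean q f"
proof -
  \<comment> \<open>Superlevel sets of \<open>f\<close>. Since \<open>ennreal\<close> maps negative
    reals to \<open>0\<close>, the condition \<open>0 \<le> r\<close> is what keeps negative levels
    from being counted.\<close>
  define B where "B r = (\<Union>j\<in>S. {j} \<times> {l. 0 \<le> r \<and> ennreal r < f j l})" for r
  have [measurable]: "f j \<in> borel_measurable borel" if "j \<in> S" for j
    using measurable_family_apply[OF f that, of "\<lambda>_. 0" borel "\<lambda>x. x"] by simp
  have B: "B r \<in> sets (count_space UNIV \<Otimes>\<^sub>M borel)" for r
    unfolding B_def by (intro sets.finite_UN finite_S pair_measureI) auto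
  have ind: "indicator (B r) (j, l) = (indicator {r. 0 \<le> r \<and> ennreal r < f j l} r :: ennreal)"
    if "j \<in> S" for r j l
    using that by (auto simp: B_def split: split_indicator)
  show ?thesis
  proof (rule invariant_nn_integral)
    show "measurable_family lborel (\<lambda>r j l. indicator (B r) (j, l))"
    proof (rule measurable_familyI)
      fix j assume j: "j \<in> S"
      then have [measurable]: "f j \<in> borel_measurable borel" by simp
      show "(\<lambda>(r, l). indicator (B r) (j, l) :: ennreal) \<in> borel_measurable (lborel \<Otimes>\<^sub>M lborel)"
        unfolding ind[OF j] unfolding indicator_def by measurable
    qed
    show "f j l = (\<integral>\<^sup>+ r. indicator (B r) (j, l) \<partial>lborel)" if "j \<in> S" for j l
      by (simp add: ind[OF that] nn_integral_layer_cake)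
    show "(\<Sum>n. mean q (kern n t (\<lambda>j l. indicator (B r) (j, l)))) = mean q (\<lambda>j l. indicator (B r) (j, l))" for r
      using inv t B by (simp add: invariant_iff)
  qed
qed

lemma invariant_imp_transport:
  assumes inv: "pdmp_invariant S a v q" and t: "t \<ge> 0" and j: "j \<in> S"
  shows "transport t q j l = q j l"
proof -
  have eq: "mean q f = mean (transport t q) f" if f: "measurable_family lborel (\<lambda>_::real. f)" for f
  proof -
    have mG: "measurable_family lborel (\<lambda>r. kern n (t - r) (jump (flow r f)))" for n
      by (intro measurable_family_kern measurable_family_jump measurable_family_flow f) auto
    have mJ: "measurable_family lborel (\<lambda>_::real. jump (flow r f))" for r
      by (intro measurable_family_jump measurable_family_flow f) auto
    have mI: "(\<lambda>r. indicator {0..t} r * mean q (kern n (t - r) (jump (flow r f)))) \<in> borel_measurable lborel" for n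
      by (intro borel_measurable_times_ennreal measurable_mean[OF mG]) auto
    have "mean q (kern (Suc n) t f) = (\<integral>\<^sup>+ r. indicator {0..t} r * mean q (kern n (t - r) (jump (flow r f))) \<partial>lborel)" for n
    proof -
      have "mean q (kern (Suc n) t f) =
          mean q (\<lambda>j l. \<integral>\<^sup>+ r. indicator {0..t} r * kern n (t - r) (jump (flow r f)) j l \<partial>lborel)"
        by (intro mean_cong kern_last_jump f)
      also have "\<dots> = (\<integral>\<^sup>+ r. mean q (\<lambda>j l. indicator {0..t} r * kern n (t - r) (jump (flow r f)) j l) \<partial>lborel)"
        by (intro mean_nn_integral measurable_family_scale mG) auto
      also have "\<dots> = (\<integral>\<^sup>+ r. indicator {0..t} r * mean q (kern n (t - r) (jump (flow r f))) \<partial>lborel)"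
        by (intro nn_integral_cong) (auto simp: mean_def split: split_indicator)
      finally show ?thesis .
    qed
    \<comment> \<open>Summing over the number \<open>n\<close> of jumps before the last one builds
      the full semigroup at time \<open>t - r\<close>, applied to \<open>jump (flow r f)\<close>;
      invariance then removes it.\<close>
    then have "(\<Sum>n. mean q (kern (Suc n) t f)) =
        (\<integral>\<^sup>+ r. indicator {0..t} r * (\<Sum>n. mean q (kern n (t - r) (jump (flow r f)))) \<partial>lborel)"
      by (simp add: nn_integral_suminf[OF mI, symmetric] ennreal_suminf_cmult del: kern.simps)
    also have "\<dots> = (\<integral>\<^sup>+ r. indicator {0..t} r * mean q (jump (flow r f)) \<partial>lborel)"
      by (intro nn_integral_cong) (auto simp: invariant_function[OF inv _ mJ] split: split_indicator)
    finally have "(\<Sum>n. mean q (kern (Suc n) t f)) = \<dots>" .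
    moreover have "(\<Sum>n. mean q (kern n t f)) = mean q (kern 0 t f) + (\<Sum>n. mean q (kern (Suc n) t f))"
      using suminf_offset[of "\<lambda>n. mean q (kern n t f)" 1] by (simp del: kern.simps)
    ultimately show ?thesis
      using invariant_function[OF inv t f] mean_transport[OF f, of t] by simp
  qed
  show ?thesis
  proof (rule continuous_eqI_nn_integral_ball[OF continuous_transport[OF j] q_cont[OF j] transport_nonneg[OF j] q_nonneg[OF j]])
    fix x r
    \<comment> \<open>A test function living in mode \<open>j\<close> alone isolates one component
      of the densities.\<close>
    let ?f = "\<lambda>i (l :: 'a). if i = j then indicator (ball x r) l else 0 :: ennreal"
    have "mean p ?f = (\<Sum>i\<in>S. if i = j then \<integral>\<^sup>+ l. ennreal (p j l) * indicator (ball x r) l \<partial>lborel else 0)" for p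
      unfolding mean_def by (intro sum.cong) auto
    then have m: "mean p ?f = (\<integral>\<^sup>+ l. ennreal (p j l) * indicator (ball x r) l \<partial>lborel)" for p
      using j finite_S by simp
    have "indicator (ball x r) \<in> borel_measurable lborel"
      by (intro borel_measurable_indicator) simp
    from measurable_compose[OF measurable_snd this]
    have "(\<lambda>z. ?f i (snd z)) \<in> borel_measurable (lborel \<Otimes>\<^sub>M lborel)" for i
      by (cases "i = j") simp_all
    then have "measurable_family lborel (\<lambda>_::real. ?f)"
      by (intro measurable_familyI) (simp add: split_beta')
    from eq[OF this] show "(\<integral>\<^sup>+ l. ennreal (transport t q j l) * indicator (ball x r) l \<partial>lborel) =
        (\<integral>\<^sup>+ l. ennreal (q j l) * indicator (ball x r) l \<partial>lborel)"
      by (simp add: m)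
  qed
qed

text \<open>Iterating the fixed point equation leaves the mass that has jumped more than \<open>n\<close> times.\<close>
lemma mean_iterate:
  assumes fixed: "\<And>t j l. t \<ge> 0 \<Longrightarrow> j \<in> S \<Longrightarrow> transport t q j l = q j l"
    and f: "measurable_family lborel (\<lambda>_::real. f)" and t: "t \<ge> 0"
  shows "mean q f = (\<Sum>k\<le>n. mean q (kern k t f)) +
    (\<integral>\<^sup>+ s. indicator {0..t} s * mean q (jump (kern n s f)) \<partial>lborel)"
proof (induction n)
  have dual: "mean q f = mean q (flow t f) + (\<integral>\<^sup>+ s. indicator {0..t} s * mean q (jump (flow s f)) \<partial>lborel)"
    if "measurable_family lborel (\<lambda>_::real. f)" "t \<ge> 0" for f t
    unfolding mean_transport[OF that(1)] using fixed[OF that(2)]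
    by (simp add: mean_def)
  case 0
  show ?case using dual[OF f t] by simp
  case (Suc n)
  have mJ: "measurable_family lborel (\<lambda>_::real. jump (kern n s f))" for s
    by (intro measurable_family_jump measurable_family_kern f) auto
  have mf: "measurable_family M (\<lambda>_. f)" for M :: "'m measure"
    by (rule measurable_family_const[OF f])
  let ?\<Psi> = "\<lambda>s r. mean q (jump (flow r (jump (kern n s f))))"
  have \<Psi>: "(\<lambda>(s, r). ?\<Psi> s r) \<in> borel_measurable (lborel \<Otimes>\<^sub>M lborel)"
    unfolding split_beta
    by (intro measurable_mean measurable_family_jump measurable_family_flow measurable_family_kern mf) auto
  have mR: "(\<lambda>s. mean q (flow (t - s) (jump (kern n s f)))) \<in> borel_measurable lborel"
    by (intro measurable_mean measurable_family_jump measurable_family_flow measurable_family_kern mf) auto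
  have mR': "(\<lambda>s. \<integral>\<^sup>+ r. indicator {0..t - s} r * ?\<Psi> s r \<partial>lborel) \<in> borel_measurable lborel"
    using \<Psi> by measurable
  \<comment> \<open>The identity \<open>dual\<close> is applied to \<open>jump (kern n s f)\<close>
    over the remaining time \<open>t - s\<close>. Its flow part becomes the term with
    \<open>n + 1\<close> jumps, its integral part the next remainder.\<close>
  have "(\<integral>\<^sup>+ s. indicator {0..t} s * mean q (jump (kern n s f)) \<partial>lborel) =
    (\<integral>\<^sup>+ s. indicator {0..t} s * mean q (flow (t - s) (jump (kern n s f))) +
       indicator {0..t} s * (\<integral>\<^sup>+ r. indicator {0..t - s} r * ?\<Psi> s r \<partial>lborel) \<partial>lborel)"
    by (intro nn_integral_cong) (auto simp: dual[OF mJ] split: split_indicator)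
  also have "\<dots> = (\<integral>\<^sup>+ s. indicator {0..t} s * mean q (flow (t - s) (jump (kern n s f))) \<partial>lborel) +
    (\<integral>\<^sup>+ s. indicator {0..t} s * (\<integral>\<^sup>+ r. indicator {0..t - s} r * ?\<Psi> s r \<partial>lborel) \<partial>lborel)"
    using mR mR' by (intro nn_integral_add) auto
  also have "(\<integral>\<^sup>+ s. indicator {0..t} s * mean q (flow (t - s) (jump (kern n s f))) \<partial>lborel) = mean q (kern (Suc n) t f)"
  proof -
    have mG: "measurable_family lborel (\<lambda>s j l. indicator {0..t} s * flow s (jump (kern n (t - s) f)) j l)"
      by (intro measurable_family_scale measurable_family_jump measurable_family_flow measurable_family_kern mf) auto
    show ?thesis
      unfolding kern.simps mean_integral[OF mG] nn_integral_reflect[OF mR]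
      by (intro nn_integral_cong) (auto simp: mean_def split: split_indicator)
  qed
  also have "(\<integral>\<^sup>+ s. indicator {0..t} s * (\<integral>\<^sup>+ r. indicator {0..t - s} r * ?\<Psi> s r \<partial>lborel) \<partial>lborel) =
     (\<integral>\<^sup>+ w. indicator {0..t} w * (\<integral>\<^sup>+ r. indicator {0..w} r * ?\<Psi> (w - r) r \<partial>lborel) \<partial>lborel)"
    by (rule nn_integral_triangle_shift[OF \<Psi>])
  also have "\<dots> = (\<integral>\<^sup>+ w. indicator {0..t} w * mean q (jump (kern (Suc n) w f)) \<partial>lborel)"
  proof (rule nn_integral_cong)
    fix w :: real
    have mG: "measurable_family lborel (\<lambda>r j l. indicator {0..w} r * flow r (jump (kern n (w - r) f)) j l)"
      by (intro measurable_family_scale measurable_family_jump measurable_family_flow measurable_family_kern mf) auto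
    have "mean q (jump (kern (Suc n) w f)) =
        mean q (\<lambda>j l. \<integral>\<^sup>+ r. jump (\<lambda>j l. indicator {0..w} r * flow r (jump (kern n (w - r) f)) j l) j l \<partial>lborel)"
      unfolding kern.simps by (intro mean_cong jump_nn_integral mG)
    also have "\<dots> = (\<integral>\<^sup>+ r. mean q (jump (\<lambda>j l. indicator {0..w} r * flow r (jump (kern n (w - r) f)) j l)) \<partial>lborel)"
      by (intro mean_nn_integral measurable_family_jump mG) auto
    also have "\<dots> = (\<integral>\<^sup>+ r. indicator {0..w} r * ?\<Psi> (w - r) r \<partial>lborel)"
      by (intro nn_integral_cong) (auto simp: mean_def jump_def split: split_indicator)
    finally show "indicator {0..t} w * (\<integral>\<^sup>+ r. indicator {0..w} r * ?\<Psi> (w - r) r \<partial>lborel) =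
      indicator {0..t} w * mean q (jump (kern (Suc n) w f))" by simp
  qed
  finally show ?case
    using Suc by (simp add: add.assoc del: kern.simps)
qed

text \<open>The remainder in \<open>mean_iterate\<close> is at most a constant times
  \<open>(C * t) ^ n / fact n\<close> by \<open>kern_bound\<close>, the constant being finite
  because \<open>q\<close> has finite total mass \<open>m\<close>.\<close>

lemma mean_kern_bounded_support:
  assumes fixed: "\<And>t j l. t \<ge> 0 \<Longrightarrow> j \<in> S \<Longrightarrow> transport t q j l = q j l"
    and f: "measurable_family lborel (\<lambda>_::real. f)" and t: "t \<ge> 0"
    and bound: "\<And>j l. j \<in> S \<Longrightarrow> f j l \<le> indicator (cball 0 R) l"
  shows "(\<Sum>n. mean q (kern n t f)) = mean q f"
proof -
  define V where "V = (\<Sum>j\<in>S. norm (v j))"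
  have V: "norm (v j) \<le> V" if "j \<in> S" for j
    unfolding V_def using that finite_S by (auto intro!: member_le_sum)
  obtain C where C: "C \<ge> 0" "\<And>j l. j \<in> S \<Longrightarrow> norm l \<le> R + t * V \<Longrightarrow> pdmp_rate S a j l \<le> C"
    by (rule rate_bounded[of "R + t * V"]) auto
  have V0: "V \<ge> 0"
    unfolding V_def by (intro sum_nonneg) auto
  have "(\<Sum>j\<in>S. \<integral>\<^sup>+ l. ennreal (q j l) \<partial>lborel) < \<infinity>"
    using q_integrable finite_S by (simp add: less_top)
  then obtain m where m: "(\<Sum>j\<in>S. \<integral>\<^sup>+ l. ennreal (q j l) \<partial>lborel) = ennreal m" "m \<ge> 0"
    by (cases "\<Sum>j\<in>S. \<integral>\<^sup>+ l. ennreal (q j l) \<partial>lborel") auto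
  define R' where "R' n = (\<integral>\<^sup>+ s. indicator {0..t} s * mean q (jump (kern n s f)) \<partial>lborel)" for n
  have R'_le: "R' n \<le> ennreal (t * C * m * ((C * t) ^ n / fact n))" for n
  proof -
    let ?c = "C * ((C * t) ^ n / fact n)"
    have "R' n \<le> (\<integral>\<^sup>+ s. ennreal (?c * m) * indicator {0..t} s \<partial>lborel)"
      unfolding R'_def
    proof (rule nn_integral_mono)
      fix s :: real
      show "indicator {0..t} s * mean q (jump (kern n s f)) \<le> ennreal (?c * m) * indicator {0..t} s"
      proof (cases "s \<in> {0..t}")
        case True
        have "mean q (jump (kern n s f)) \<le> (\<Sum>j\<in>S. \<integral>\<^sup>+ l. ennreal ?c * ennreal (q j l) \<partial>lborel)"
          unfolding mean_def
        proof (intro sum_mono nn_integral_mono)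
          fix j l assume j: "j \<in> S"
          have "jump (kern n s f) j l \<le> ennreal (C * ((C * s) ^ n / fact n)) * indicator (cball 0 (R + s * V)) l"
            using kern_bound[where t=t, OF V V0 C(2,1) bound j] True by auto
          also have "\<dots> \<le> ennreal ?c * 1"
            using True C(1) by (intro mult_mono ennreal_leI mult_left_mono divide_right_mono power_mono)
              (auto split: split_indicator)
          finally show "ennreal (q j l) * jump (kern n s f) j l \<le> ennreal ?c * ennreal (q j l)"
            by (simp add: mult.commute mult_left_mono)
        qed
        also have "\<dots> = ennreal ?c * (\<Sum>j\<in>S. \<integral>\<^sup>+ l. ennreal (q j l) \<partial>lborel)"
          unfolding sum_distrib_left by (intro sum.cong nn_integral_cmult) auto
        also have "\<dots> = ennreal (?c * m)"
          unfolding m(1) using C(1) t m(2) by (intro ennreal_mult[symmetric]) auto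
        finally show ?thesis using True by simp
      qed auto
    qed
    also have "\<dots> = ennreal (?c * m) * ennreal t"
      using t by (simp add: nn_integral_cmult_indicator)
    also have "\<dots> = ennreal (t * C * m * ((C * t) ^ n / fact n))"
      using C(1) t m by (simp add: ennreal_mult[symmetric] mult_ac)
    finally show ?thesis .
  qed
  have "(\<lambda>n. (C * t) ^ n / fact n) \<longlonglongrightarrow> 0"
    using summable_LIMSEQ_zero[OF summable_exp[of "C * t"]] by (simp only: divide_inverse mult.commute)
  then have "(\<lambda>n. ennreal (t * C * m * ((C * t) ^ n / fact n))) \<longlonglongrightarrow> ennreal (t * C * m * 0)"
    by (intro tendsto_ennrealI tendsto_mult_left)
  then have "(\<lambda>n. ennreal (t * C * m * ((C * t) ^ n / fact n))) \<longlonglongrightarrow> 0"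
    by simp
  then have "R' \<longlonglongrightarrow> 0"
    by (rule tendsto_sandwich[OF _ _ tendsto_const, rotated 2]) (auto intro!: always_eventually R'_le simp del: times_divide_eq_right)
  moreover have "(\<lambda>n. \<Sum>k\<le>n. mean q (kern k t f)) \<longlonglongrightarrow> (\<Sum>n. mean q (kern n t f))"
    by (intro summable_LIMSEQ') auto
  ultimately have "(\<lambda>n. (\<Sum>k\<le>n. mean q (kern k t f)) + R' n) \<longlonglongrightarrow> (\<Sum>n. mean q (kern n t f)) + 0"
    by (intro tendsto_add)
  then have "(\<lambda>n. mean q f) \<longlonglongrightarrow> (\<Sum>n. mean q (kern n t f))"
    using mean_iterate[OF fixed f t] by (simp add: R'_def)
  then show ?thesis
    by (simp add: LIMSEQ_const_iff)
qed

lemma transport_imp_invariant: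
  assumes fixed: "\<And>t j l. t \<ge> 0 \<Longrightarrow> j \<in> S \<Longrightarrow> transport t q j l = q j l"
  shows "pdmp_invariant S a v q"
  unfolding invariant_iff
proof (intro allI impI ballI)
  fix t :: real and B :: "(nat \<times> 'a) set"
  assume t: "t \<ge> 0" and B: "B \<in> sets (count_space UNIV \<Otimes>\<^sub>M borel)"
  \<comment> \<open>For each \<open>l\<close> the admissible \<open>r\<close> form an interval of
    length one, so integration over \<open>r\<close> gives back the indicator of \<open>B\<close>;
    for fixed \<open>r\<close> the slice lives in \<open>cball 0 r\<close>, hence has bounded
    support.\<close>
  let ?F = "\<lambda>r j l. indicator {norm l..<norm l + 1} r * indicator B (j, l) :: ennreal"
  have mF: "measurable_family M (\<lambda>m. ?F (\<tau> m))" if [measurable]: "\<tau> \<in> borel_measurable M" for M :: "'m measure" and \<tau>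
  proof (rule measurable_familyI)
    fix j assume j: "j \<in> S"
    have "indicator {norm l..<norm l + 1} r = (if norm l \<le> r \<and> r < norm l + 1 then 1 else 0 :: ennreal)"
      for l :: 'a and r
      by (auto split: split_indicator)
    moreover have "(\<lambda>(m, l). indicator B (j, l) :: ennreal) \<in> borel_measurable (M \<Otimes>\<^sub>M lborel)"
      using measurable_family_indicator[OF B, of M] j by (simp add: measurable_family_def)
    ultimately show "(\<lambda>(m, l). ?F (\<tau> m) j l) \<in> borel_measurable (M \<Otimes>\<^sub>M lborel)"
      unfolding split_beta' by (intro borel_measurable_times_ennreal) auto
  qed
  show "(\<Sum>n. mean q (kern n t (\<lambda>j l. indicator B (j, l)))) = mean q (\<lambda>j l. indicator B (j, l))"
  proof (rule invariant_nn_integral)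
    show "measurable_family lborel ?F" by (rule mF) simp
    show "indicator B (j, l) = (\<integral>\<^sup>+ r. ?F r j l \<partial>lborel)" for j l
      by (simp add: nn_integral_multc)
    show "(\<Sum>n. mean q (kern n t (?F r))) = mean q (?F r)" for r
      by (rule mean_kern_bounded_support[OF fixed mF t, where R = r]) (auto split: split_indicator)
  qed
qed

text \<open>Both sides are equivalent to \<open>q\<close> being fixed by \<open>transport t\<close>
  for all \<open>t \<ge> 0\<close>.\<close>

theorem invariant_iff_stationary:
  "pdmp_invariant S a v q \<longleftrightarrow>
    (\<forall>j\<in>S. \<forall>l. - frechet_derivative (q j) (at l) (v j) +
        (\<Sum>i\<in>S - {j}. q i l * a i j l - q j l * a j i l) = 0)"
  using transport_fixed_iff transport_imp_invariant invariant_imp_transport by blast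

end

section \<open>Densities of product form\<close>

theorem theorem2p1:
  fixes N :: nat
    and v :: "nat \<Rightarrow> real ^ 'd"
    and a :: "nat \<Rightarrow> nat \<Rightarrow> real ^ 'd \<Rightarrow> real"
    and p :: "nat \<Rightarrow> real"
    and g :: "real ^ 'd \<Rightarrow> real"
  assumes "N > 1"
    and "\<exists>j\<in>{1..N}. v j \<noteq> 0"
    and "dim (span (v ` {1..N})) = CARD('d)"
    and "\<And>i j. i \<in> {1..N} \<Longrightarrow> j \<in> {1..N} \<Longrightarrow> i \<noteq> j \<Longrightarrow> continuous_on UNIV (a i j)"
    and "\<And>i j l. i \<in> {1..N} \<Longrightarrow> j \<in> {1..N} \<Longrightarrow> i \<noteq> j \<Longrightarrow> a i j l \<ge> 0"
    and "pdmp_harris_irreducible {1..N} a v"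
    and "\<And>j. j \<in> {1..N} \<Longrightarrow> p j > 0"
    and "(\<Sum>j\<in>{1..N}. p j) = 1"
    and "\<And>l. g l \<ge> 0"
    and "\<And>l. g differentiable (at l)"
    and "(\<integral>\<^sup>+ l. ennreal (g l) \<partial>lborel) = 1"
  shows "pdmp_invariant {1..N} a v (\<lambda>j l. p j * g l) \<longleftrightarrow>
    (\<forall>j\<in>{1..N}. \<forall>l.
       - p j * frechet_derivative g (at l) (v j)
       + (\<Sum>i\<in>{1..N} - {j}. p i * a i j l * g l - p j * a j i l * g l) = 0)"
proof -
  have p: "p j \<ge> 0" if "j \<in> {1..N}" for j
    using assms(7)[OF that] by simp
  have meas: "g \<in> borel_measurable borel"
    by (intro borel_measurable_continuous_onI continuous_at_imp_continuous_on ballI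
        differentiable_imp_continuous_within assms(10))
  interpret pdmp_density "{1..N}" a v "\<lambda>j l. p j * g l"
  proof
    show "(\<integral>\<^sup>+ l. ennreal (p j * g l) \<partial>lborel) < \<infinity>" if "j \<in> {1..N}" for j
      using p[OF that] meas assms(11) by (simp add: ennreal_mult' nn_integral_cmult)
    show "continuous_on UNIV (a i j)" if "i \<in> {1..N}" "j \<in> {1..N}" "i \<noteq> j" for i j
      using assms(4) that .
    show "a i j l \<ge> 0" if "i \<in> {1..N}" "j \<in> {1..N}" "i \<noteq> j" for i j l
      using assms(5) that .
    show "(\<lambda>l. p j * g l) differentiable at l" for j l
      using assms(10) by simp
    show "p j * g l \<ge> 0" if "j \<in> {1..N}" for j l
      using p[OF that] assms(9) by simp
  qed simp
  \<comment> \<open>Brings the equation for the densities \<open>p j * g l\<close> into the form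
    stated in terms of \<open>g\<close>.\<close>
  have "frechet_derivative (\<lambda>l. p j * g l) (at l) = (\<lambda>h. p j * frechet_derivative g (at l) h)" for j l
  proof (rule frechet_derivative_at[symmetric])
    have "(g has_derivative frechet_derivative g (at l)) (at l)"
      using assms(10) frechet_derivative_works by blast
    then show "((\<lambda>l. p j * g l) has_derivative (\<lambda>h. p j * frechet_derivative g (at l) h)) (at l)"
      by (rule has_derivative_mult_right)
  qed
  then show ?thesis
    unfolding invariant_iff_stationary by (simp add: mult_ac)
qed

end
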